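(* Suppose that a linear partial monitoring game (with domain $\mathcal D$ and Legendre potential $F$ satisfying the standing assumptions in the context, with $\operatorname{diam}(\mathcal D)>0$) has an $(\alpha,\beta,\lambda)$ adaptive information ratio, where $\beta(z,a)$ is a function of the signal $\Phi_a(z)$ and of $a$ only, written $\beta(\sigma,a)$, and $\beta_0=\sup_{\sigma\in\Sigma}\max_{a\in\mathcal A}\beta(\sigma,a)\in(0,\infty)$. Let $n\ge1$, $\epsilon>0$ and $$\eta_t=\lambda^{1/\lambda}(\lambda-1)^{1-1/\lambda}\left(\frac{\operatorname{diam}(\mathcal D)}{\beta_0+\sum_{s=1}^{t-1}\beta(\sigma_s,A_s)}\right)^{1-1/\lambda}.$$ Consider a policy that in each round $t$ computes $$Q_t=\arg\min_{q\in\mathcal D}\ \sum_{s=1}^{t-1}\langle q,\hat\ell_s\rangle+\frac{F(q)}{\eta_t},\qquad \hat\ell_s=\frac{G_s(A_s,\sigma_s)}{P_s(A_s)},$$ chooses (as a function of the history) $P_t\in\mathcal P_+$ and $G_t\in\mathcal G$ such that $$\sup_{z\in\mathcal Z,\,a^*\in\mathcal D}\left[\Lambda_{Q_t,\eta_t}(z,a^*,P_t,G_t)-\left(1-\frac1\lambda\right)\left(\frac{\eta_t}\lambda\right)^{\frac1{\lambda-1}}\sum_{a\in\mathcal A}P_t(a)\beta(\Phi_a(z),a)\right]\le\epsilon+\alpha,$$ and samples $A_t\sim P_t$. Then, for every sequence $(z_t)_{t=1}^n$ in $\mathcal Z$, the regret of this policy is bounded by $$\mathfrak R_n\le n(\epsilon+\epsilon_{\mathcal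 D}+\alpha)+\left(\frac\lambda{\lambda-1}\right)^{1-\frac1\lambda}\operatorname{diam}(\mathcal D)^{\frac1\lambda}\,\mathbb E\left[\left(\beta_0+\sum_{t=1}^{n-1}\beta(\sigma_t,A_t)\right)^{1-\frac1\lambda}\right].$$
   Context: A linear partial monitoring game is given by an action set $\mathcal A\subset\mathbb R^d$, a signal set $\Sigma$, a latent set $\mathcal Z$, a signal function $\Phi:\mathcal A\times\mathcal Z\to\Sigma$, written $\Phi_a(z)$, and a loss function $\ell:\mathcal Z\to[0,1]^d$; $\Phi$ and $\ell$ are known to the learner. An adversary secretly fixes $(z_t)_{t=1}^n$ in $\mathcal Z$. In round $t$ the learner samples $A_t$ from a distribution $P_t$ on $\mathcal A$ depending on past actions and signals, and observes $\sigma_t=\Phi_{A_t}(z_t)$. The regret is $\mathfrak R_n=\max_{a\in\mathcal A}\mathbb E[\sum_{t=1}^n\langle A_t-a,\ell(z_t)\rangle]$. Standing assumptions. $F:\mathbb R^d\to\mathbb R\cup\{\infty\}$ is Legendre (proper, convex, lower semi-continuous, essentially smooth and essentially strictly convex). $\mathcal D\subset\operatorname{conv}(\mathcal A)$ is compact, convex and has non-empty relative interior. Moreover: (a) $1<|\mathcal A|<\infty$; (b) $\langle a,\ell(z)\rangle\in[0,1]$ for all $a\in\mathcal A$, $z\in\mathcal Z$; (c) $\mathcal D\subset\operatorname{dom}(F)=\{x:F(x)<\infty\}$; (d) $\operatorname{diam}(\mathcal D)=\sup_{x,y\in\mathcal D}(F(x)-F(y))<\infty$. Notation. $\mathcal P$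 is the set of probability distributions on $\mathcal A$ and $\mathcal P_+=\{p\in\mathcal P: p(a)>0\ \forall a\in\mathcal A\}$. $F^\star(u)=\sup_{x\in\mathbb R^d}\langle u,x\rangle-F(x)$. Bregman divergences: $\operatorname{D}(p,q)=F(p)-F(q)-\langle\nabla F(q),p-q\rangle$ and $\operatorname{D}_\star(x,y)=F^\star(x)-F^\star(y)-\langle\nabla F^\star(y),x-y\rangle$. If $F$ is not differentiable at $q$, then $\langle\nabla F(q),p-q\rangle$ is read as the one-sided directional derivative $\lim_{h\to0^+}(F(q+h(p-q))-F(q))/h$. $\operatorname{dom}(\nabla F)$ is the set where $F$ is differentiable. For $q\in\mathcal D\cap\operatorname{dom}(\nabla F)$, $\Psi_q(x)=\operatorname{D}_\star(\nabla F(q)-x,\nabla F(q))$. $\mathcal V$ is the set of finitely supported probability distributions on $\mathcal Z\times\mathcal D$. $\mathcal G$ is the set of all functions from $\mathcal A\times\Sigma$ to $\mathbb R^d$. $\epsilon_{\mathcal D}=\max_{a\in\mathcal A}\min_{b\in\mathcal D}\sup_{z\in\mathcal Z}\langle b-a,\ell(z)\rangle$. Adaptive information ratio. Let $\alpha\in\mathbb R$, $\beta:\mathcal Z\times\mathcal A\to[0,\infty)$ and $\lambda>1$. The game has an $(\alpha,\beta,\lambda)$ adaptive information ratio if for all $\nu\in\mathcal V$ there exists $p\in\mathcal P$ such that when $(Z,A^*,A)$ has law $\nu\otimes p$ (i.e. $(Z,A^* )\sim\nu$ and $A\sim p$ independently), $$\mathbb E[\langle A-A^*,\ell(Z)\rangle]\le\alpha+\big(\mathbb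 E[\beta(Z,A)]\big)^{1-1/\lambda}\,\big(\mathbb E[\operatorname{D}(\mathbb E[A^*\mid\Phi_A(Z),A],\mathbb E[A^*])]\big)^{1/\lambda}.$$ Objective. For $\eta>0$, $q\in\mathcal D\cap\operatorname{dom}(\nabla F)$, $z\in\mathcal Z$, $a^*\in\mathcal D$, $p\in\mathcal P_+$, $g\in\mathcal G$, $$\Lambda_{q,\eta}(z,a^*,p,g)=\sum_{a\in\mathcal A}p(a)\langle a-a^*,\ell(z)\rangle+\Big\langle a^*-q,\sum_{a\in\mathcal A}g(a,\Phi_a(z))\Big\rangle+\frac1\eta\sum_{a\in\mathcal A}p(a)\Psi_q\left(\frac{\eta g(a,\Phi_a(z))}{p(a)}\right).$$ It is understood that the iterates $Q_t$ lie in $\mathcal D\cap\operatorname{dom}(\nabla F)$, so that $\Lambda_{Q_t,\eta_t}$ is defined. *)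

theory Defs
  imports "HOL-Probability.Probability"
begin

section \<open>Convex analysis for extended-real-valued functions\<close>

definition eff_dom :: "('v \<Rightarrow> ereal) \<Rightarrow> 'v set" where
  "eff_dom f = {x. f x < \<infinity>}"

text \<open>Differentiability at a point includes finiteness in a neighbourhood of it.\<close>

definition has_gradient :: "('v::euclidean_space \<Rightarrow> ereal) \<Rightarrow> 'v \<Rightarrow> 'v \<Rightarrow> bool" where
  "has_gradient f x g \<longleftrightarrow>
     x \<in> interior {y. \<bar>f y\<bar> \<noteq> \<infinity>} \<and> GDERIV (\<lambda>y. real_of_ereal (f y)) x :> g"

definition gradient :: "('v::euclidean_space \<Rightarrow> ereal) \<Rightarrow> 'v \<Rightarrow> 'v" where
  "gradient f x = (THE g. has_gradient f x g)"

definition dom_gradient :: "('v::euclidean_space \<Rightarrow> ereal) \<Rightarrow> 'v set" where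
  "dom_gradient f = {x. \<exists>g. has_gradient f x g}"

definition subdifferential :: "('v::euclidean_space \<Rightarrow> ereal) \<Rightarrow> 'v \<Rightarrow> 'v set" where
  "subdifferential f x = {g. \<forall>y. f x + ereal (g \<bullet> (y - x)) \<le> f y}"

definition proper_fun :: "('v \<Rightarrow> ereal) \<Rightarrow> bool" where
  "proper_fun f \<longleftrightarrow> (\<forall>x. f x \<noteq> -\<infinity>) \<and> (\<exists>x. f x < \<infinity>)"

definition convex_fun :: "('v::real_vector \<Rightarrow> ereal) \<Rightarrow> bool" where
  "convex_fun f \<longleftrightarrow> convex {(x, r::real). f x \<le> ereal r}"

definition lsc_fun :: "('v::topological_space \<Rightarrow> ereal) \<Rightarrow> bool" where
  "lsc_fun f \<longleftrightarrow> (\<forall>x. f x \<le> Liminf (nhds x) f)"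

definition essentially_smooth :: "('v::euclidean_space \<Rightarrow> ereal) \<Rightarrow> bool" where
  "essentially_smooth f \<longleftrightarrow>
     interior (eff_dom f) \<noteq> {} \<and>
     interior (eff_dom f) \<subseteq> dom_gradient f \<and>
     (\<forall>X x. (\<forall>i::nat. X i \<in> interior (eff_dom f)) \<and>
        x \<in> frontier (interior (eff_dom f)) \<and> X \<longlonglongrightarrow> x \<longrightarrow>
        filterlim (\<lambda>i. norm (gradient f (X i))) at_top sequentially)"

definition essentially_strictly_convex :: "('v::euclidean_space \<Rightarrow> ereal) \<Rightarrow> bool" where
  "essentially_strictly_convex f \<longleftrightarrow>
     (\<forall>C. convex C \<and> C \<subseteq> {x. subdifferential f x \<noteq> {}} \<longrightarrow>
        (\<forall>x\<in>C. \<forall>y\<in>C. \<forall>u::real. x \<noteq> y \<and> 0 < u \<and> u < 1 \<longrightarrow>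
           f (u *\<^sub>R x + (1 - u) *\<^sub>R y) < ereal u * f x + ereal (1 - u) * f y))"

definition Legendre_fun :: "('v::euclidean_space \<Rightarrow> ereal) \<Rightarrow> bool" where
  "Legendre_fun f \<longleftrightarrow> proper_fun f \<and> convex_fun f \<and> lsc_fun f \<and>
     essentially_smooth f \<and> essentially_strictly_convex f"

definition conjugate :: "('v::euclidean_space \<Rightarrow> ereal) \<Rightarrow> 'v \<Rightarrow> ereal" where
  "conjugate f u = (SUP x. ereal (u \<bullet> x) - f x)"

definition dir_deriv :: "('v::euclidean_space \<Rightarrow> ereal) \<Rightarrow> 'v \<Rightarrow> 'v \<Rightarrow> ereal" where
  "dir_deriv f q v = Lim (at_right 0) (\<lambda>h::real. (f (q + h *\<^sub>R v) - f q) / ereal h)"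

definition bregman :: "('v::euclidean_space \<Rightarrow> ereal) \<Rightarrow> 'v \<Rightarrow> 'v \<Rightarrow> ereal" where
  "bregman F p q = F p - F q -
     (if q \<in> dom_gradient F then ereal (gradient F q \<bullet> (p - q)) else dir_deriv F q (p - q))"

definition bregman_star :: "('v::euclidean_space \<Rightarrow> ereal) \<Rightarrow> 'v \<Rightarrow> 'v \<Rightarrow> ereal" where
  "bregman_star F x y = conjugate F x - conjugate F y - ereal (gradient (conjugate F) y \<bullet> (x - y))"

definition Psi :: "('v::euclidean_space \<Rightarrow> ereal) \<Rightarrow> 'v \<Rightarrow> 'v \<Rightarrow> ereal" where
  "Psi F q x = bregman_star F (gradient F q - x) (gradient F q)"

definition diamF :: "('v \<Rightarrow> ereal) \<Rightarrow> 'v set \<Rightarrow> ereal" where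
  "diamF F D = (SUP x\<in>D. SUP y\<in>D. F x - F y)"


section \<open>Linear partial monitoring games\<close>

definition linear_pm_game ::
  "(real^'d) set \<Rightarrow> 's set \<Rightarrow> 'z set \<Rightarrow> (real^'d \<Rightarrow> 'z \<Rightarrow> 's) \<Rightarrow> ('z \<Rightarrow> real^'d) \<Rightarrow> bool" where
  "linear_pm_game A S Z \<Phi> l \<longleftrightarrow>
     finite A \<and> 1 < card A \<and>
     (\<forall>a\<in>A. \<forall>z\<in>Z. \<Phi> a z \<in> S) \<and>
     (\<forall>z\<in>Z. \<forall>i. 0 \<le> l z $ i \<and> l z $ i \<le> 1) \<and>
     (\<forall>a\<in>A. \<forall>z\<in>Z. 0 \<le> a \<bullet> l z \<and> a \<bullet> l z \<le> 1)"

definition standing_domain :: "(real^'d) set \<Rightarrow> (real^'d) set \<Rightarrow> (real^'d \<Rightarrow> ereal) \<Rightarrow> bool" where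
  "standing_domain A D F \<longleftrightarrow>
     D \<subseteq> convex hull A \<and> compact D \<and> convex D \<and> rel_interior D \<noteq> {} \<and>
     D \<subseteq> eff_dom F \<and> diamF F D < \<infinity>"

text \<open>The infimum over \<open>D\<close> is attained because \<open>D\<close> is compact and \<open>l\<close> is bounded on \<open>Z\<close>.\<close>

definition eps_D :: "(real^'d) set \<Rightarrow> 'z set \<Rightarrow> ('z \<Rightarrow> real^'d) \<Rightarrow> (real^'d) set \<Rightarrow> real" where
  "eps_D A Z l D = (MAX a\<in>A. INF b\<in>D. SUP z\<in>Z. (b - a) \<bullet> l z)"


subsection \<open>Adaptive information ratio\<close>

text \<open>Outcomes are \<open>((z, b), a)\<close>, with \<open>b\<close> the value of \<open>A*\<close>. The laws considered are finitely
  supported, so conditional expectations given \<open>(\<Phi>\<^sub>A(Z), A)\<close> are elementary ones.\<close>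

definition posterior_mean ::
  "(real^'d \<Rightarrow> 'z \<Rightarrow> 's) \<Rightarrow> (('z \<times> (real^'d)) \<times> (real^'d)) pmf \<Rightarrow> ('z \<times> (real^'d)) \<times> (real^'d) \<Rightarrow> real^'d"
  where
  "posterior_mean \<Phi> \<mu> \<omega> =
     (let X = (\<lambda>((z, b), a). (\<Phi> a z, a))
      in measure_pmf.expectation (cond_pmf \<mu> {\<omega>'. X \<omega>' = X \<omega>}) (\<lambda>((z, b), a). b))"

text \<open>Taking the real part of the Bregman divergence loses nothing: for \<open>\<omega>\<close> in the support, the prior
  mean is a convex combination, with positive weight on the posterior mean, of the posterior mean
  and another point of \<open>D\<close>. As \<open>F\<close> is convex and finite on \<open>D\<close>, the divergence is finite.\<close>

definition adaptive_information_ratio ::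
  "(real^'d) set \<Rightarrow> 'z set \<Rightarrow> (real^'d \<Rightarrow> 'z \<Rightarrow> 's) \<Rightarrow> ('z \<Rightarrow> real^'d) \<Rightarrow> (real^'d) set \<Rightarrow>
   (real^'d \<Rightarrow> ereal) \<Rightarrow> real \<Rightarrow> ('z \<Rightarrow> real^'d \<Rightarrow> real) \<Rightarrow> real \<Rightarrow> bool" where
  "adaptive_information_ratio A Z \<Phi> l D F \<alpha> \<beta> lam \<longleftrightarrow>
     (\<forall>\<nu> :: ('z \<times> (real^'d)) pmf. finite (set_pmf \<nu>) \<and> set_pmf \<nu> \<subseteq> Z \<times> D \<longrightarrow>
       (\<exists>p :: (real^'d) pmf. set_pmf p \<subseteq> A \<and>
         measure_pmf.expectation (pair_pmf \<nu> p) (\<lambda>((z, b), a). (a - b) \<bullet> l z)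
         \<le> \<alpha> + measure_pmf.expectation (pair_pmf \<nu> p) (\<lambda>((z, b), a). \<beta> z a) powr (1 - 1 / lam) *
             measure_pmf.expectation (pair_pmf \<nu> p)
               (\<lambda>\<omega>. real_of_ereal (bregman F (posterior_mean \<Phi> (pair_pmf \<nu> p) \<omega>)
                                              (measure_pmf.expectation \<nu> snd))) powr (1 / lam)))"


subsection \<open>Objective\<close>

text \<open>Extended-real-valued, as the conjugate of \<open>F\<close> may take the value \<open>\<infinity>\<close>.\<close>

definition Lam ::
  "(real^'d) set \<Rightarrow> (real^'d \<Rightarrow> 'z \<Rightarrow> 's) \<Rightarrow> ('z \<Rightarrow> real^'d) \<Rightarrow> (real^'d \<Rightarrow> ereal) \<Rightarrow>
   real^'d \<Rightarrow> real \<Rightarrow> 'z \<Rightarrow> real^'d \<Rightarrow> (real^'d) pmf \<Rightarrow> (real^'d \<Rightarrow> 's \<Rightarrow> real^'d) \<Rightarrow> ereal" where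
  "Lam A \<Phi> l F q \<eta> z b p g =
     ereal (\<Sum>a\<in>A. pmf p a * ((a - b) \<bullet> l z)) +
     ereal ((b - q) \<bullet> (\<Sum>a\<in>A. g a (\<Phi> a z))) +
     ereal (1 / \<eta>) * (\<Sum>a\<in>A. ereal (pmf p a) * Psi F q ((\<eta> / pmf p a) *\<^sub>R g a (\<Phi> a z)))"


subsection \<open>Policies and their interaction with the game\<close>

text \<open>A history lists the pairs (action, signal) of the past rounds in chronological order; after
  \<open>length h\<close> rounds with history \<open>h\<close>, the learner samples from \<open>P h\<close>. Position \<open>s\<close> of the list
  (from 0) holds round \<open>s + 1\<close>, while the latent sequence \<open>z\<close> is indexed from 1.\<close>

type_synonym ('d, 's) history = "((real^'d) \<times> 's) list"

primrec interaction ::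
  "(real^'d \<Rightarrow> 'z \<Rightarrow> 's) \<Rightarrow> (('d, 's) history \<Rightarrow> (real^'d) pmf) \<Rightarrow> (nat \<Rightarrow> 'z) \<Rightarrow> nat \<Rightarrow>
   ('d, 's) history pmf" where
  "interaction \<Phi> P z 0 = return_pmf []"
| "interaction \<Phi> P z (Suc t) =
     bind_pmf (interaction \<Phi> P z t)
       (\<lambda>h. map_pmf (\<lambda>a. h @ [(a, \<Phi> a (z (Suc t)))]) (P h))"

definition regret ::
  "(real^'d) set \<Rightarrow> (real^'d \<Rightarrow> 'z \<Rightarrow> 's) \<Rightarrow> ('z \<Rightarrow> real^'d) \<Rightarrow>
   (('d, 's) history \<Rightarrow> (real^'d) pmf) \<Rightarrow> (nat \<Rightarrow> 'z) \<Rightarrow> nat \<Rightarrow> real" where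
  "regret A \<Phi> l P z n =
     (MAX a\<in>A. measure_pmf.expectation (interaction \<Phi> P z n)
        (\<lambda>h. \<Sum>t=1..n. (fst (h ! (t - 1)) - a) \<bullet> l (z t)))"

text \<open>Histories that can arise against some latent sequence when every action has positive probability.\<close>

definition possible_history ::
  "(real^'d) set \<Rightarrow> 'z set \<Rightarrow> (real^'d \<Rightarrow> 'z \<Rightarrow> 's) \<Rightarrow> ('d, 's) history \<Rightarrow> bool" where
  "possible_history A Z \<Phi> h \<longleftrightarrow> (\<forall>(a, \<sigma>)\<in>set h. a \<in> A \<and> (\<exists>z\<in>Z. \<sigma> = \<Phi> a z))"

definition cum_beta :: "('s \<Rightarrow> real^'d \<Rightarrow> real) \<Rightarrow> ('d, 's) history \<Rightarrow> real" where
  "cum_beta \<beta> h = (\<Sum>(a, \<sigma>)\<leftarrow>h. \<beta> \<sigma> a)"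

text \<open>The learning rate of round \<open>length h + 1\<close>.\<close>

definition learning_rate ::
  "real \<Rightarrow> real \<Rightarrow> real \<Rightarrow> ('s \<Rightarrow> real^'d \<Rightarrow> real) \<Rightarrow> ('d, 's) history \<Rightarrow> real" where
  "learning_rate lam dm \<beta>0 \<beta> h =
     lam powr (1 / lam) * (lam - 1) powr (1 - 1 / lam) *
     (dm / (\<beta>0 + cum_beta \<beta> h)) powr (1 - 1 / lam)"

text \<open>The estimate of round \<open>s + 1\<close>, where \<open>take s h\<close> is the history before that round.\<close>

definition loss_estimate ::
  "(('d, 's) history \<Rightarrow> (real^'d) pmf) \<Rightarrow> (('d, 's) history \<Rightarrow> real^'d \<Rightarrow> 's \<Rightarrow> real^'d) \<Rightarrow>
   ('d, 's) history \<Rightarrow> nat \<Rightarrow> real^'d" where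
  "loss_estimate P G h s =
     (let (a, \<sigma>) = h ! s in (1 / pmf (P (take s h)) a) *\<^sub>R G (take s h) a \<sigma>)"

definition ftrl_objective ::
  "(real^'d \<Rightarrow> ereal) \<Rightarrow> (('d, 's) history \<Rightarrow> (real^'d) pmf) \<Rightarrow>
   (('d, 's) history \<Rightarrow> real^'d \<Rightarrow> 's \<Rightarrow> real^'d) \<Rightarrow> real \<Rightarrow> ('d, 's) history \<Rightarrow> real^'d \<Rightarrow> ereal" where
  "ftrl_objective F P G \<eta> h q =
     ereal (\<Sum>s<length h. q \<bullet> loss_estimate P G h s) + F q / ereal \<eta>"

end

theory Submission
  imports Defs
begin

text \<open>Strict convexity makes \<open>F(x) - F(q) - \<langle>\<nabla>F(q), x - q\<rangle>\<close> grow at least linearly away from \<open>q\<close>,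
  so \<open>F\<^sup>*\<close> is differentiable at \<open>\<nabla>F(q)\<close> with gradient \<open>q\<close>. Fenchel--Young then gives
  \<open>\<Psi>\<^sub>q(x) \<ge> \<langle>q - w, x\<rangle> - D(w, q)\<close> for all \<open>w\<close>, which is the stability estimate for one step of
  follow-the-regularised-leader; telescoping bounds the regret with respect to the estimated losses
  by \<open>diam(D) / \<eta>\<^sub>n + \<Sum>\<^sub>t \<Psi>(\<eta>\<^sub>t e\<^sub>t) / \<eta>\<^sub>t\<close> on every history, where \<open>e\<^sub>t\<close> is the estimate of round
  \<open>t\<close>. In conditional expectation, the hypothesis on \<open>\<Lambda>\<close> trades this for \<open>\<epsilon> + \<alpha>\<close> per round plus
  multiples of \<open>\<beta>(\<sigma>\<^sub>t, A\<^sub>t)\<close>. As \<open>\<beta>\<^sub>0\<close> dominates the missing last summand, these are bounded by an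
  integral of \<open>x powr (- 1 / \<lambda>)\<close>, and the learning rate is chosen so that both contributions
  scale as \<open>(\<beta>\<^sub>0 + \<Sum> \<beta>) powr (1 - 1 / \<lambda>)\<close>. Passing from \<open>A\<close> to \<open>D\<close> as benchmark costs \<open>\<epsilon>\<^sub>D\<close> per round.\<close>

section \<open>Convex functions and their gradients\<close>

lemma ereal_real_eff_dom:
  assumes "proper_fun F" "x \<in> eff_dom F"
  shows "F x = ereal (real_of_ereal (F x))"
  using assms by (auto simp: proper_fun_def eff_dom_def ereal_real)

text \<open>Where \<open>F\<close> is finite, \<open>(x, F x)\<close> lies in the epigraph, so
  convexity of the epigraph yields both the convexity of the domain and the inequality between real
  values.\<close>

lemma convex_on_real_eff_dom:
  assumes "proper_fun F" "convex_fun F"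
  shows "convex_on (eff_dom F) (\<lambda>x. real_of_ereal (F x))"
proof -
  have *: "F (u *\<^sub>R x + v *\<^sub>R y) \<le> ereal (u * real_of_ereal (F x) + v * real_of_ereal (F y))"
    if "x \<in> eff_dom F" "y \<in> eff_dom F" "0 \<le> u" "0 \<le> v" "u + v = 1" for x y u v
  proof -
    have "F x \<le> ereal (real_of_ereal (F x))" "F y \<le> ereal (real_of_ereal (F y))"
      using ereal_real_eff_dom[OF assms(1)] that(1,2) by auto
    then have "u *\<^sub>R (x, real_of_ereal (F x)) + v *\<^sub>R (y, real_of_ereal (F y)) \<in> {(x, r::real). F x \<le> ereal r}"
      using assms(2) that unfolding convex_fun_def
      by (intro convexD) auto
    then show ?thesis by simp
  qed
  have cv: "convex (eff_dom F)"
  proof (rule convexI)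
    fix x y u v
    assume "x \<in> eff_dom F" "y \<in> eff_dom F" "0 \<le> (u::real)" "0 \<le> v" "u + v = 1"
    from *[OF this] show "u *\<^sub>R x + v *\<^sub>R y \<in> eff_dom F"
      by (auto simp: eff_dom_def intro: le_less_trans)
  qed
  show ?thesis
    unfolding convex_on_def
  proof (intro conjI cv ballI allI impI)
    fix x y u v
    assume h: "x \<in> eff_dom F" "y \<in> eff_dom F" "0 \<le> (u::real)" "0 \<le> v" "u + v = 1"
    have "u *\<^sub>R x + v *\<^sub>R y \<in> eff_dom F" using cv h by (rule convexD)
    from ereal_real_eff_dom[OF assms(1) this] *[OF h]
    show "real_of_ereal (F (u *\<^sub>R x + v *\<^sub>R y)) \<le> u * real_of_ereal (F x) + v * real_of_ereal (F y)"
      by (metis ereal_less_eq(3))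
  qed
qed

lemma has_gradient_unique:
  assumes "has_gradient F x g" "has_gradient F x g'"
  shows "g = g'"
proof -
  have "(\<lambda>h. h \<bullet> g) = (\<lambda>h. h \<bullet> g')"
    using assms unfolding has_gradient_def gderiv_def by (blast intro: has_derivative_unique)
  then have "(g - g') \<bullet> g = (g - g') \<bullet> g'" by metis
  then have "(g - g') \<bullet> (g - g') = 0" by (simp add: inner_diff_right)
  then show ?thesis by simp
qed

lemma gradient_eq:
  assumes "has_gradient F x g"
  shows "gradient F x = g"
  unfolding gradient_def using assms has_gradient_unique by blast

lemma has_gradient_gradient:
  assumes "x \<in> dom_gradient F"
  shows "has_gradient F x (gradient F x)"
  using assms gradient_eq unfolding dom_gradient_def by fastforce

lemma has_gradient_eff_dom:
  assumes "has_gradient F x g"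
  shows "x \<in> eff_dom F"
proof -
  have "x \<in> {y. \<bar>F y\<bar> \<noteq> \<infinity>}"
    using assms unfolding has_gradient_def by (auto dest: subsetD[OF interior_subset])
  then show ?thesis by (auto simp: eff_dom_def)
qed

text \<open>The chain rule along a line gives a two-sided limit. Only the right half is kept,
  because a segment from \<open>x\<close> to another point of a convex set is traversed with
  \<open>h > 0\<close>.\<close>

lemma has_gradient_dir:
  assumes "has_gradient F x g"
  shows "((\<lambda>h. (real_of_ereal (F (x + h *\<^sub>R v)) - real_of_ereal (F x)) / h) \<longlongrightarrow> g \<bullet> v) (at_right 0)"
proof -
  have 1: "((\<lambda>y. real_of_ereal (F y)) has_derivative (\<lambda>h. h \<bullet> g)) (at (x + 0 *\<^sub>R v))"
    using assms unfolding has_gradient_def gderiv_def by simp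
  have 2: "((\<lambda>h::real. x + h *\<^sub>R v) has_derivative (\<lambda>h. h *\<^sub>R v)) (at 0)"
    by (auto intro!: derivative_eq_intros)
  have "((\<lambda>h::real. real_of_ereal (F (x + h *\<^sub>R v))) has_derivative (\<lambda>h. (h *\<^sub>R v) \<bullet> g)) (at 0)"
    using diff_chain_at[OF 2 1] by (simp add: o_def)
  then have "((\<lambda>h::real. real_of_ereal (F (x + h *\<^sub>R v))) has_field_derivative (v \<bullet> g)) (at 0)"
    by (rule has_derivative_imp_has_field_derivative) (simp add: mult.commute)
  then have "((\<lambda>h. (real_of_ereal (F (x + h *\<^sub>R v)) - real_of_ereal (F x)) / h) \<longlongrightarrow> g \<bullet> v) (at 0)"
    by (simp add: has_field_derivative_iff inner_commute)
  then show ?thesis by (rule tendsto_mono[OF at_le[OF subset_UNIV]])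
qed

text \<open>On the segment from \<open>x\<close> to \<open>w\<close>, convexity bounds each
  difference quotient by its value at \<open>h = 1\<close>, and the bound survives the limit at
  \<open>0\<close>.\<close>

lemma gradient_inequality:
  assumes "proper_fun F" "convex_fun F" "has_gradient F x g" "w \<in> eff_dom F"
  shows "real_of_ereal (F x) + g \<bullet> (w - x) \<le> real_of_ereal (F w)"
proof -
  let ?f = "\<lambda>x. real_of_ereal (F x)"
  have ev: "\<forall>\<^sub>F h in at_right 0. (?f (x + h *\<^sub>R (w - x)) - ?f x) / h \<le> ?f w - ?f x"
    unfolding eventually_at_right_field
  proof (intro exI[of _ 1] conjI allI impI)
    fix h :: real assume h: "0 < h" "h < 1"
    have "?f ((1 - h) *\<^sub>R x + h *\<^sub>R w) \<le> (1 - h) * ?f x + h * ?f w"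
      using convex_on_real_eff_dom[OF assms(1,2)] has_gradient_eff_dom[OF assms(3)] assms(4) h
      unfolding convex_on_def by auto
    moreover have "(1 - h) *\<^sub>R x + h *\<^sub>R w = x + h *\<^sub>R (w - x)" by (simp add: algebra_simps)
    ultimately show "(?f (x + h *\<^sub>R (w - x)) - ?f x) / h \<le> ?f w - ?f x"
      using h by (simp add: field_simps)
  qed simp
  have "g \<bullet> (w - x) \<le> ?f w - ?f x"
    by (rule tendsto_upperbound[OF has_gradient_dir[OF assms(3)] ev]) simp
  then show ?thesis by simp
qed

text \<open>Minimality along the segment from \<open>x\<close> to \<open>w\<close> bounds the
  difference quotients of \<open>F\<close> from below; their limit is the variational inequality of
  the constrained minimum.\<close>

lemma first_order_optimality:
  assumes "has_gradient F x g" "convex D" "x \<in> D" "w \<in> D"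
    and min: "\<And>y. y \<in> D \<Longrightarrow> c \<bullet> x + real_of_ereal (F x) \<le> c \<bullet> y + real_of_ereal (F y)"
  shows "0 \<le> (c + g) \<bullet> (w - x)"
proof -
  let ?f = "\<lambda>x. real_of_ereal (F x)"
  have ev: "\<forall>\<^sub>F h in at_right 0. - (c \<bullet> (w - x)) \<le> (?f (x + h *\<^sub>R (w - x)) - ?f x) / h"
    unfolding eventually_at_right_field
  proof (intro exI[of _ 1] conjI allI impI)
    fix h :: real assume h: "0 < h" "h < 1"
    have "(1 - h) *\<^sub>R x + h *\<^sub>R w \<in> D"
      using assms(2-4) h by (intro convexD) auto
    moreover have "(1 - h) *\<^sub>R x + h *\<^sub>R w = x + h *\<^sub>R (w - x)" by (simp add: algebra_simps)
    ultimately have "c \<bullet> x + ?f x \<le> c \<bullet> (x + h *\<^sub>R (w - x)) + ?f (x + h *\<^sub>R (w - x))"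
      using min by metis
    then have "- (c \<bullet> (w - x)) * h \<le> ?f (x + h *\<^sub>R (w - x)) - ?f x"
      by (simp add: inner_add_right mult.commute)
    then show "- (c \<bullet> (w - x)) \<le> (?f (x + h *\<^sub>R (w - x)) - ?f x) / h"
      using h by (simp add: pos_le_divide_eq)
  qed simp
  have "- (c \<bullet> (w - x)) \<le> g \<bullet> (w - x)"
    by (rule tendsto_lowerbound[OF has_gradient_dir[OF assms(1)] ev]) simp
  then show ?thesis by (simp add: inner_add_left)
qed

section \<open>Legendre functions and their conjugates\<close>

lemma finite_eq_eff_dom:
  assumes "proper_fun F"
  shows "{y. \<bar>F y\<bar> \<noteq> \<infinity>} = eff_dom F"
  using assms by (auto simp: proper_fun_def eff_dom_def)

text \<open>At the midpoint of \<open>x\<close> and \<open>q\<close>, strict convexity bounds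
  \<open>F\<close> strictly from above by the average of the end values, while the gradient
  inequality at \<open>q\<close> bounds it from below.\<close>

lemma Legendre_bregman_pos:
  assumes "Legendre_fun F" "has_gradient F q g" "x \<in> interior (eff_dom F)" "x \<noteq> q"
  shows "real_of_ereal (F q) + g \<bullet> (x - q) < real_of_ereal (F x)"
proof -
  let ?f = "\<lambda>x. real_of_ereal (F x)"
  have L: "proper_fun F" "convex_fun F" "essentially_smooth F" "essentially_strictly_convex F"
    using assms(1) unfolding Legendre_fun_def by auto
  let ?C = "interior (eff_dom F)"
  have q: "q \<in> ?C" using assms(2) finite_eq_eff_dom[OF L(1)] unfolding has_gradient_def by simp
  have cD: "convex (eff_dom F)"
    using convex_on_real_eff_dom[OF L(1,2)] by (simp add: convex_on_def)
  have cC: "convex ?C" using cD by (rule convex_interior)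
  \<comment> \<open>Essential strict convexity speaks of convex sets of points with a subgradient.
    Essential smoothness provides gradients on the interior of the domain, and these are
    subgradients.\<close>
  have sub: "?C \<subseteq> {x. subdifferential F x \<noteq> {}}"
  proof
    fix y assume "y \<in> ?C"
    then have gy: "has_gradient F y (gradient F y)"
      using L(3) has_gradient_gradient unfolding essentially_smooth_def by blast
    have "F y + ereal (gradient F y \<bullet> (w - y)) \<le> F w" for w
    proof (cases "w \<in> eff_dom F")
      case True
      show ?thesis
        using gradient_inequality[OF L(1,2) gy True] ereal_real_eff_dom[OF L(1) True]
          ereal_real_eff_dom[OF L(1) has_gradient_eff_dom[OF gy]]
        by (metis ereal_less_eq(3) plus_ereal.simps(1))
    next
      case False
      then show ?thesis by (auto simp: eff_dom_def)
    qed
    then show "y \<in> {x. subdifferential F x \<noteq> {}}" unfolding subdifferential_def by blast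
  qed
  let ?m = "(1/2) *\<^sub>R x + (1 - 1/2) *\<^sub>R q"
  have xd: "x \<in> eff_dom F" "q \<in> eff_dom F" using assms(3) q interior_subset by auto
  have "F ?m < ereal (1/2) * F x + ereal (1 - 1/2) * F q"
    using L(4)[unfolded essentially_strictly_convex_def, rule_format, of ?C x q "1/2"]
      cC sub assms(3,4) q by simp
  moreover have md: "?m \<in> eff_dom F" using cD xd by (intro convexD) auto
  ultimately have "?f ?m < ?f x / 2 + ?f q / 2"
    using xd by (subst (asm) (1 2 3) ereal_real_eff_dom[OF L(1)]) auto
  moreover have "?f q + g \<bullet> (?m - q) \<le> ?f ?m"
    by (rule gradient_inequality[OF L(1,2) assms(2) md])
  moreover have "?m - q = (1/2) *\<^sub>R (x - q)"
    by (simp add: algebra_simps) (metis scaleR_add_left scaleR_one field_sum_of_halves add.commute)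
  ultimately show ?thesis by simp
qed

text \<open>Outside the ball of radius \<open>r\<close> around \<open>q\<close>, the Bregman divergence grows at a positive linear
  rate. For \<open>u\<close> smaller than this rate, points farther than \<open>r\<close> from \<open>q\<close> contribute no more than \<open>q\<close>
  itself to the supremum defining \<open>F\<^sup>*(g + u)\<close>, so \<open>F\<^sup>*(g + u) - F\<^sup>*(g) - \<langle>u, q\<rangle>\<close> lies between \<open>0\<close> and \<open>r |u|\<close>.\<close>

lemma has_gradient_conjugate:
  fixes F :: "'v::euclidean_space \<Rightarrow> ereal"
  assumes "Legendre_fun F" "has_gradient F q g"
  shows "has_gradient (conjugate F) g q"
    and "conjugate F g = ereal (g \<bullet> q - real_of_ereal (F q))"
proof -
  let ?f = "\<lambda>x. real_of_ereal (F x)"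
  define K where "K = (\<lambda>u. conjugate F (g + u))"
  define \<delta> where "\<delta> = (\<lambda>x. ?f x - ?f q - g \<bullet> (x - q))"
  have L: "proper_fun F" "convex_fun F" "essentially_smooth F" "essentially_strictly_convex F"
    using assms(1) unfolding Legendre_fun_def by auto
  let ?C = "interior (eff_dom F)"
  have q: "q \<in> ?C" using assms(2) finite_eq_eff_dom[OF L(1)] unfolding has_gradient_def by simp
  have qd: "q \<in> eff_dom F" using q interior_subset by auto
  have cont: "continuous_on ?C ?f"
  proof (rule continuous_at_imp_continuous_on, rule ballI)
    fix y assume "y \<in> ?C"
    then have "has_gradient F y (gradient F y)"
      using L(3) has_gradient_gradient unfolding essentially_smooth_def by blast
    then show "isCont ?f y"
      unfolding has_gradient_def gderiv_def using has_derivative_continuous by blast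
  qed
  have \<delta>0: "0 \<le> \<delta> x" if "x \<in> eff_dom F" for x
    using gradient_inequality[OF L(1,2) assms(2) that] by (simp add: \<delta>_def)
  have low: "ereal ((g + u) \<bullet> q - ?f q) \<le> K u" for u
    unfolding K_def conjugate_def
    by (rule SUP_upper2[of q]) (use ereal_real_eff_dom[OF L(1) qd] in \<open>auto, metis ereal_minus(1) order_refl\<close>)
  \<comment> \<open>By the definition of \<open>\<delta>\<close>, the term of \<open>x\<close> in
    the supremum is the term of \<open>q\<close> plus
    \<open>u \<bullet> (x - q) - \<delta> x\<close>, so only this excess has to be bounded.\<close>
  have up: "K u \<le> ereal ((g + u) \<bullet> q - ?f q + B)"
    if B: "\<And>x. x \<in> eff_dom F \<Longrightarrow> u \<bullet> (x - q) - \<delta> x \<le> B" for u B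
    unfolding K_def conjugate_def
  proof (rule SUP_least)
    fix x
    show "ereal ((g + u) \<bullet> x) - F x \<le> ereal ((g + u) \<bullet> q - ?f q + B)"
    proof (cases "x \<in> eff_dom F")
      case True
      have "(g + u) \<bullet> x - ?f x \<le> (g + u) \<bullet> q - ?f q + B"
        using B[OF True] unfolding \<delta>_def by (simp add: inner_add_left inner_diff_right)
      then show ?thesis using ereal_real_eff_dom[OF L(1) True] by (metis ereal_less_eq(3) ereal_minus(1))
    next
      case False
      then show ?thesis by (auto simp: eff_dom_def)
    qed
  qed
  have K0: "K 0 = ereal (g \<bullet> q - ?f q)"
    using low[of 0] up[of 0 0] \<delta>0 by (intro antisym) auto
  then show "conjugate F g = ereal (g \<bullet> q - ?f q)" by (simp add: K_def)
  obtain r0 where r0: "r0 > 0" "cball q r0 \<subseteq> ?C"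
    using q open_interior open_contains_cball by blast
  have near: "\<exists>d>0. \<forall>u. norm u < d \<longrightarrow> K u \<le> ereal ((g + u) \<bullet> q - ?f q + norm u * r)"
    if r: "0 < r" "r \<le> r0" for r
  proof -
    have S: "sphere q r \<subseteq> ?C" using r0 r by (auto simp: subset_iff)
    have "continuous_on (sphere q r) \<delta>"
      unfolding \<delta>_def by (intro continuous_intros continuous_on_subset[OF cont S])
    \<comment> \<open>The sphere is compact and avoids \<open>q\<close>, so the minimum of
      \<open>\<delta>\<close> on it is attained and positive; \<open>\<delta> x0 / r\<close> is the
      growth rate sought.\<close>
    then obtain x0 where x0: "x0 \<in> sphere q r" "\<And>y. y \<in> sphere q r \<Longrightarrow> \<delta> x0 \<le> \<delta> y"
      using continuous_attains_inf[of "sphere q r" \<delta>] r by (auto simp: compact_sphere)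
    have "x0 \<noteq> q" using x0(1) r by auto
    then have c: "0 < \<delta> x0"
      using Legendre_bregman_pos[OF assms, of x0] x0(1) S by (auto simp: \<delta>_def)
    have far: "\<delta> x0 * norm (x - q) \<le> r * \<delta> x" if x: "x \<in> eff_dom F" "r \<le> norm (x - q)" for x
    proof -
      \<comment> \<open>This \<open>t\<close> places \<open>?p\<close> on the sphere, and
        \<open>\<delta>\<close> is convex with value \<open>0\<close> at \<open>q\<close>, whence
        \<open>\<delta> x0 \<le> \<delta> ?p \<le> t * \<delta> x\<close>.\<close>
      define t where "t = r / norm (x - q)"
      have np: "0 < norm (x - q)" using x r by linarith
      have t: "0 < t" "t \<le> 1" using np x r by (auto simp: t_def)
      let ?p = "(1 - t) *\<^sub>R q + t *\<^sub>R x"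
      have pq: "?p - q = t *\<^sub>R (x - q)" by (simp add: algebra_simps)
      have "norm (?p - q) = r" unfolding pq using np r by (simp add: t_def)
      then have "?p \<in> sphere q r" by (simp add: dist_norm norm_minus_commute)
      then have "\<delta> x0 \<le> \<delta> ?p" by (rule x0(2))
      also have "?f ?p \<le> (1 - t) * ?f q + t * ?f x"
        using convex_on_real_eff_dom[OF L(1,2)] qd x(1) t unfolding convex_on_def by auto
      then have "\<delta> ?p \<le> t * \<delta> x"
        unfolding \<delta>_def pq by (simp add: algebra_simps)
      finally show ?thesis using np by (simp add: t_def field_simps)
    qed
    show ?thesis
    proof (intro exI[of _ "\<delta> x0 / r"] conjI allI impI)
      show "0 < \<delta> x0 / r" using c r by simp
      fix u :: 'v assume u: "norm u < \<delta> x0 / r"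
      show "K u \<le> ereal ((g + u) \<bullet> q - ?f q + norm u * r)"
      proof (rule up)
        fix x assume x: "x \<in> eff_dom F"
        have cs: "u \<bullet> (x - q) \<le> norm u * norm (x - q)" by (rule norm_cauchy_schwarz)
        show "u \<bullet> (x - q) - \<delta> x \<le> norm u * r"
        proof (cases "r \<le> norm (x - q)")
          case True
          have "norm u * norm (x - q) \<le> \<delta> x0 / r * norm (x - q)"
            using u by (intro mult_right_mono) auto
          also have "\<dots> \<le> \<delta> x" using far[OF x True] r by (simp add: field_simps)
          finally have "u \<bullet> (x - q) - \<delta> x \<le> 0" using cs by linarith
          also have "0 \<le> norm u * r" using r by simp
          finally show ?thesis .
        next
          case False
          then have "norm u * norm (x - q) \<le> norm u * r" by (intro mult_left_mono) auto
          then show ?thesis using cs \<delta>0[OF x] by linarith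
        qed
      qed
    qed
  qed
  have fin: "\<bar>K u\<bar> \<noteq> \<infinity>" if "K u \<le> ereal B" for u B
    using low[of u] that by (cases "K u") auto
  have "g \<in> interior {y. \<bar>conjugate F y\<bar> \<noteq> \<infinity>}"
  proof -
    obtain d where d: "d > 0" "\<And>u. norm u < d \<Longrightarrow> K u \<le> ereal ((g + u) \<bullet> q - ?f q + norm u * r0)"
      using near[of r0] r0 by auto
    have "ball g d \<subseteq> {y. \<bar>conjugate F y\<bar> \<noteq> \<infinity>}"
    proof
      fix y assume "y \<in> ball g d"
      then have "norm (y - g) < d" by (simp add: dist_norm norm_minus_commute)
      from fin[OF d(2)[OF this]] show "y \<in> {y. \<bar>conjugate F y\<bar> \<noteq> \<infinity>}" by (simp add: K_def)
    qed
    with d(1) show ?thesis by (meson centre_in_ball interior_maximal open_ball subsetD)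
  qed
  moreover have "((\<lambda>y. real_of_ereal (conjugate F y)) has_derivative (\<lambda>h. h \<bullet> q)) (at g)"
    unfolding has_derivative_at_alt
  proof (intro conjI allI impI bounded_linear_inner_left)
    fix e :: real assume e: "0 < e"
    \<comment> \<open>The radius is at most \<open>e\<close> for the error bound and at most
      \<open>r0\<close> so that the sphere stays inside the domain.\<close>
    obtain d where d: "d > 0"
      "\<And>u. norm u < d \<Longrightarrow> K u \<le> ereal ((g + u) \<bullet> q - ?f q + norm u * min e r0)"
      using near[of "min e r0"] e r0 by auto
    show "\<exists>d>0. \<forall>y. norm (y - g) < d \<longrightarrow> norm (real_of_ereal (conjugate F y) -
        real_of_ereal (conjugate F g) - (y - g) \<bullet> q) \<le> e * norm (y - g)"
    proof (intro exI[of _ d] conjI allI impI d(1))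
      fix y assume "norm (y - g) < d"
      note 1 = d(2)[OF this]
      have 2: "K (y - g) = ereal (real_of_ereal (K (y - g)))" using fin[OF 1] by (simp add: ereal_real)
      have "real_of_ereal (K (y - g)) \<le> (g + (y - g)) \<bullet> q - ?f q + norm (y - g) * min e r0"
        using 1 2 by (metis ereal_less_eq(3))
      moreover have "norm (y - g) * min e r0 \<le> norm (y - g) * e" by (intro mult_left_mono) auto
      moreover have "(g + (y - g)) \<bullet> q - ?f q \<le> real_of_ereal (K (y - g))"
        using low[of "y - g"] 2 by (metis ereal_less_eq(3))
      moreover have "real_of_ereal (conjugate F g) = g \<bullet> q - ?f q" using K0 by (simp add: K_def)
      moreover have "K (y - g) = conjugate F y" by (simp add: K_def)
      ultimately show "norm (real_of_ereal (conjugate F y) -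
        real_of_ereal (conjugate F g) - (y - g) \<bullet> q) \<le> e * norm (y - g)"
        by (simp add: abs_le_iff inner_diff_left mult.commute)
    qed
  qed
  ultimately show "has_gradient (conjugate F) g q"
    unfolding has_gradient_def gderiv_def by blast
qed

section \<open>Regret of follow-the-regularised-leader\<close>

text \<open>The point \<open>w\<close> is a candidate in the supremum for the conjugate at
  \<open>gradient F q - x\<close>. At \<open>gradient F q\<close> itself the conjugate and its
  gradient are known explicitly. An infinite conjugate makes the bound trivial.\<close>

lemma Psi_lower_bound:
  fixes F :: "'v::euclidean_space \<Rightarrow> ereal"
  assumes "Legendre_fun F" "q \<in> dom_gradient F" "w \<in> eff_dom F"
  shows "ereal ((q - w) \<bullet> x - (real_of_ereal (F w) - real_of_ereal (F q) - gradient F q \<bullet> (w - q)))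
     \<le> Psi F q x"
proof -
  let ?g = "gradient F q"
  have L: "proper_fun F" using assms(1) unfolding Legendre_fun_def by auto
  note gq = has_gradient_gradient[OF assms(2)]
  note c = has_gradient_conjugate[OF assms(1) gq]
  have "ereal ((?g - x) \<bullet> w) - F w \<le> conjugate F (?g - x)"
    unfolding conjugate_def by (rule SUP_upper) simp
  moreover have "F w = ereal (real_of_ereal (F w))" by (rule ereal_real_eff_dom[OF L assms(3)])
  ultimately have 1: "ereal ((?g - x) \<bullet> w - real_of_ereal (F w)) \<le> conjugate F (?g - x)"
    by (metis ereal_minus(1))
  show ?thesis
    unfolding Psi_def bregman_star_def gradient_eq[OF c(1)] c(2)
    using 1 by (cases "conjugate F (?g - x)") (auto simp: inner_diff_left inner_diff_right inner_commute)
qed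

text \<open>Here \<open>u\<close> is the sum of the past estimates and \<open>v\<close> the current
  one. Optimality of \<open>q\<close> makes the regularised objective at \<open>w\<close> exceed
  that at \<open>q\<close> by at least the Bregman divergence over \<open>\<eta>\<close>, which is
  exactly what \<open>Psi\<close> needs to pay for \<open>(q - w) \<bullet> v\<close>.\<close>

lemma ftrl_step:
  fixes F :: "'v::euclidean_space \<Rightarrow> ereal"
  assumes "Legendre_fun F" "q \<in> dom_gradient F" "convex D" "D \<subseteq> eff_dom F" "q \<in> D" "w \<in> D" "0 < \<eta>"
    and min: "\<And>y. y \<in> D \<Longrightarrow> u \<bullet> q + real_of_ereal (F q) / \<eta> \<le> u \<bullet> y + real_of_ereal (F y) / \<eta>"
    and \<psi>: "Psi F q (\<eta> *\<^sub>R v) = ereal \<psi>"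
  shows "u \<bullet> q + real_of_ereal (F q) / \<eta> + q \<bullet> v - \<psi> / \<eta> \<le> u \<bullet> w + real_of_ereal (F w) / \<eta> + w \<bullet> v"
proof -
  let ?f = "\<lambda>x. real_of_ereal (F x)"
  have "(\<eta> *\<^sub>R u) \<bullet> q + ?f q \<le> (\<eta> *\<^sub>R u) \<bullet> y + ?f y" if "y \<in> D" for y
    using mult_left_mono[OF min[OF that], of \<eta>] assms(7) by (simp add: distrib_left)
  from first_order_optimality[OF has_gradient_gradient[OF assms(2)] assms(3,5,6) this]
  have 1: "0 \<le> \<eta> * (u \<bullet> w) - \<eta> * (u \<bullet> q) + gradient F q \<bullet> (w - q)"
    by (simp add: inner_add_left inner_diff_right right_diff_distrib)
  have "w \<in> eff_dom F" using assms(4,6) by (rule subsetD)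
  from Psi_lower_bound[OF assms(1,2) this, of "\<eta> *\<^sub>R v"]
  have 2: "\<eta> * (q \<bullet> v) - \<eta> * (w \<bullet> v) - (?f w - ?f q - gradient F q \<bullet> (w - q)) \<le> \<psi>"
    unfolding \<psi> by (simp add: inner_diff_left right_diff_distrib)
  have "\<eta> * (u \<bullet> q) + ?f q + \<eta> * (q \<bullet> v) - \<psi> \<le> \<eta> * (u \<bullet> w) + ?f w + \<eta> * (w \<bullet> v)"
    using 1 2 by linarith
  from divide_right_mono[OF this, of \<eta>] assms(7) show ?thesis
    by (simp add: add_divide_distrib diff_divide_distrib)
qed

lemma ftrl_regret_bound:
  fixes q e :: "nat \<Rightarrow> 'v::real_inner"
  assumes step: "\<And>s w. s \<le> k \<Longrightarrow> w \<in> D \<Longrightarrow>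
      (\<Sum>i<s. q s \<bullet> e i) + f (q s) / \<eta> s + q s \<bullet> e s - \<psi> s / \<eta> s
      \<le> (\<Sum>i<s. w \<bullet> e i) + f w / \<eta> s + w \<bullet> e s"
    and q: "\<And>s. s \<le> k \<Longrightarrow> q s \<in> D"
    and pos: "\<And>s. s \<le> k \<Longrightarrow> 0 < \<eta> s"
    and dec: "\<And>s. s < k \<Longrightarrow> \<eta> (Suc s) \<le> \<eta> s"
    and low: "\<And>w. w \<in> D \<Longrightarrow> m \<le> f w"
    and b: "b \<in> D" "f b \<le> m + dm"
  shows "(\<Sum>i\<le>k. (q i - b) \<bullet> e i) \<le> dm / \<eta> k + (\<Sum>i\<le>k. \<psi> i / \<eta> i)"
proof -
  \<comment> \<open>The comparator \<open>w\<close> stays arbitrary so that the induction hypothesis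
    can be applied at the next iterate. The regulariser is shifted by its lower bound
    \<open>m\<close> to be nonnegative.\<close>
  have main: "(\<Sum>i\<le>j. q i \<bullet> e i - \<psi> i / \<eta> i) \<le> (\<Sum>i\<le>j. w \<bullet> e i) + (f w - m) / \<eta> j"
    if "j \<le> k" "w \<in> D" for j w
    using that
  proof (induction j arbitrary: w)
    case 0
    have "m / \<eta> 0 \<le> f (q 0) / \<eta> 0"
      using low[OF q[of 0]] pos[of 0] by (intro divide_right_mono) auto
    then show ?case using step[of 0 w] 0 by (simp add: diff_divide_distrib)
  next
    case (Suc j)
    let ?s = "Suc j"
    \<comment> \<open>The learning rate does not increase, so replacing it by the next one can only
      enlarge the nonnegative regulariser.\<close>
    have "(f (q ?s) - m) / \<eta> j \<le> (f (q ?s) - m) / \<eta> ?s"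
      using low[OF q[of ?s]] pos[of ?s] pos[of j] dec[of j] Suc.prems
      by (intro divide_left_mono mult_pos_pos) auto
    moreover have "(\<Sum>i\<le>j. q i \<bullet> e i - \<psi> i / \<eta> i) \<le> (\<Sum>i\<le>j. q ?s \<bullet> e i) + (f (q ?s) - m) / \<eta> j"
      using Suc.IH[of "q ?s"] Suc.prems q[of ?s] by simp
    ultimately show ?case
      using step[of ?s w] Suc.prems by (simp add: diff_divide_distrib lessThan_Suc_atMost)
  qed
  have "(f b - m) / \<eta> k \<le> dm / \<eta> k"
    using b(2) pos[of k] by (intro divide_right_mono) auto
  then show ?thesis using main[of k b] b(1)
    by (simp add: inner_diff_left sum_subtractf)
qed

section \<open>Sums of powers\<close>

text \<open>Concavity of the power, obtained from Young's inequality with weights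
  \<open>\<kappa>\<close> and \<open>1 - \<kappa>\<close> by multiplying with
  \<open>y powr (\<kappa> - 1)\<close>.\<close>

lemma powr_tangent:
  fixes x y \<kappa> :: real
  assumes "0 \<le> x" "0 < y" "0 < \<kappa>" "\<kappa> < 1"
  shows "x powr \<kappa> \<le> y powr \<kappa> + \<kappa> * y powr (\<kappa> - 1) * (x - y)"
proof -
  have "x powr \<kappa> * y powr (1 - \<kappa>) \<le> \<kappa> * x + (1 - \<kappa>) * y"
    using Youngs_inequality_0[of \<kappa> "1 - \<kappa>" x y] assms
    by (cases "x = 0") auto
  then have "x powr \<kappa> * y powr (1 - \<kappa>) * y powr (\<kappa> - 1) \<le> (\<kappa> * x + (1 - \<kappa>) * y) * y powr (\<kappa> - 1)"
    by (intro mult_right_mono) auto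
  moreover have "y powr (1 - \<kappa>) * y powr (\<kappa> - 1) = 1"
    using assms by (simp flip: powr_add)
  moreover have "y * y powr (\<kappa> - 1) = y powr \<kappa>"
    using assms powr_mult_base[of y "\<kappa> - 1"] by simp
  ultimately show ?thesis
    by (simp add: algebra_simps mult.assoc)
qed

text \<open>Let \<open>C\<close> be a partial sum and \<open>b\<close> the next term. As
  \<open>b \<le> \<beta>0\<close> and the exponent is negative, the weight
  \<open>(\<beta>0 + C) powr (\<kappa> - 1)\<close> is at most
  \<open>(C + b) powr (\<kappa> - 1)\<close>. The tangent at \<open>C + b\<close> then bounds the
  summand by the increment of the power, and the increments telescope.\<close>

lemma sum_powr_bound:
  fixes \<beta> :: "nat \<Rightarrow> real"
  assumes b: "\<And>i. i \<le> k \<Longrightarrow> 0 \<le> \<beta> i" "\<And>i. i \<le> k \<Longrightarrow> \<beta> i \<le> \<beta>0"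
    and "0 < \<beta>0" and \<kappa>: "0 < \<kappa>" "\<kappa> < 1"
  shows "\<kappa> * (\<Sum>i\<le>k. \<beta> i * (\<beta>0 + (\<Sum>j<i. \<beta> j)) powr (\<kappa> - 1)) \<le> (\<beta>0 + (\<Sum>j<k. \<beta> j)) powr \<kappa>"
proof -
  have main: "\<kappa> * (\<Sum>i<m. \<beta> i * (\<beta>0 + (\<Sum>j<i. \<beta> j)) powr (\<kappa> - 1)) \<le> (\<Sum>j<m. \<beta> j) powr \<kappa>"
    if "m \<le> Suc k" for m
    using that
  proof (induction m)
    case 0
    then show ?case by simp
  next
    case (Suc m)
    let ?C = "\<Sum>j<m. \<beta> j"
    have C: "0 \<le> ?C" using b(1) Suc.prems by (intro sum_nonneg) auto
    have bm: "0 \<le> \<beta> m" "\<beta> m \<le> \<beta>0" using b Suc.prems by auto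
    have "?C powr \<kappa> + \<kappa> * (\<beta> m * (\<beta>0 + ?C) powr (\<kappa> - 1)) \<le> (?C + \<beta> m) powr \<kappa>"
    proof (cases "\<beta> m = 0")
      case False
      then have pos: "0 < ?C + \<beta> m" using C bm by linarith
      have "(\<beta>0 + ?C) powr (\<kappa> - 1) \<le> (?C + \<beta> m) powr (\<kappa> - 1)"
        using pos bm \<kappa> by (intro powr_mono2') auto
      then have "\<kappa> * \<beta> m * (\<beta>0 + ?C) powr (\<kappa> - 1) \<le> \<kappa> * \<beta> m * (?C + \<beta> m) powr (\<kappa> - 1)"
        using bm \<kappa> by (intro mult_left_mono) auto
      moreover have "?C powr \<kappa> \<le> (?C + \<beta> m) powr \<kappa> + \<kappa> * (?C + \<beta> m) powr (\<kappa> - 1) * (?C - (?C + \<beta> m))"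
        using C pos \<kappa> by (rule powr_tangent)
      ultimately show ?thesis by (simp add: algebra_simps)
    qed auto
    then show ?case using Suc by (simp add: distrib_left)
  qed
  have "\<kappa> * (\<Sum>i\<le>k. \<beta> i * (\<beta>0 + (\<Sum>j<i. \<beta> j)) powr (\<kappa> - 1)) \<le> (\<Sum>j<Suc k. \<beta> j) powr \<kappa>"
    using main[of "Suc k"] by (simp add: lessThan_Suc_atMost)
  \<comment> \<open>The last term \<open>\<beta> k\<close> is traded for
    \<open>\<beta>0\<close>.\<close>
  also have "\<dots> \<le> (\<beta>0 + (\<Sum>j<k. \<beta> j)) powr \<kappa>"
    using b \<kappa> by (intro powr_mono2) (auto intro!: sum_nonneg add_nonneg_nonneg)
  finally show ?thesis .
qed

section \<open>The objective as an expected one-round bound\<close>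

text \<open>All \<open>Psi\<close> terms are nonnegative and carry positive weights, so a finite
  bound on their sum makes each of them finite, and the inequality can be read in the reals.
  Importance weighting turns the linear term into the mean of the estimated loss difference.\<close>

lemma Lam_le_imp:
  assumes "Legendre_fun F" "finite A" "q \<in> dom_gradient F" "set_pmf p = A" "0 < \<eta>"
    and le: "Lam A \<Phi> l F q \<eta> z b p g - ereal c \<le> ereal B"
  defines "\<psi> \<equiv> \<lambda>a. real_of_ereal (Psi F q ((\<eta> / pmf p a) *\<^sub>R g a (\<Phi> a z)))"
  shows "\<And>a. a \<in> A \<Longrightarrow> Psi F q ((\<eta> / pmf p a) *\<^sub>R g a (\<Phi> a z)) = ereal (\<psi> a)"
    and "(\<Sum>a\<in>A. pmf p a * ((a - b) \<bullet> l z - (q - b) \<bullet> ((1 / pmf p a) *\<^sub>R g a (\<Phi> a z)) + \<psi> a / \<eta>))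
      \<le> B + c"
proof -
  let ?X = "\<lambda>a. Psi F q ((\<eta> / pmf p a) *\<^sub>R g a (\<Phi> a z))"
  have pos: "0 < pmf p a" if "a \<in> A" for a using that assms(4) by (auto simp: pmf_positive)
  \<comment> \<open>The lower bound at \<open>w = q\<close>, where the divergence vanishes.\<close>
  have nn: "0 \<le> ?X a" for a
    using Psi_lower_bound[OF assms(1,3) has_gradient_eff_dom[OF has_gradient_gradient[OF assms(3)]]]
    by (simp add: zero_ereal_def)
  let ?S = "\<Sum>a\<in>A. ereal (pmf p a) * ?X a"
  have S: "?S \<noteq> \<infinity>"
  proof
    assume "?S = \<infinity>"
    then have "Lam A \<Phi> l F q \<eta> z b p g = \<infinity>"
      unfolding Lam_def using assms(5) by simp
    with le show False by simp
  qed
  show X: "?X a = ereal (\<psi> a)" if "a \<in> A" for a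
  proof -
    have "ereal (pmf p a) * ?X a \<noteq> \<infinity>" using S that assms(2) unfolding sum_Pinfty by auto
    then have "?X a \<noteq> \<infinity>" using pos[OF that] by auto
    then show ?thesis using nn[of a] unfolding \<psi>_def by (auto simp: ereal_real)
  qed
  have "?S = ereal (\<Sum>a\<in>A. pmf p a * \<psi> a)"
    using X by (simp flip: sum_ereal)
  then have "(\<Sum>a\<in>A. pmf p a * ((a - b) \<bullet> l z)) + (b - q) \<bullet> (\<Sum>a\<in>A. g a (\<Phi> a z))
      + 1 / \<eta> * (\<Sum>a\<in>A. pmf p a * \<psi> a) \<le> B + c"
    using le unfolding Lam_def by simp
  moreover have "(b - q) \<bullet> (\<Sum>a\<in>A. g a (\<Phi> a z))
      = (\<Sum>a\<in>A. - (pmf p a * ((q - b) \<bullet> ((1 / pmf p a) *\<^sub>R g a (\<Phi> a z)))))"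
    unfolding inner_sum_right
    by (intro sum.cong) (auto simp: inner_diff_left dest: pos)
  ultimately show "(\<Sum>a\<in>A. pmf p a * ((a - b) \<bullet> l z - (q - b) \<bullet> ((1 / pmf p a) *\<^sub>R g a (\<Phi> a z)) + \<psi> a / \<eta>))
      \<le> B + c"
    by (simp add: distrib_left right_diff_distrib sum.distrib sum_subtractf sum_negf sum_distrib_left
        del: inner_scaleR_right)
qed

section \<open>Expectations along the interaction\<close>

lemma expectation_bind_pmf_le:
  fixes h :: "'b \<Rightarrow> real"
  assumes "finite (set_pmf p)" "\<And>x. x \<in> set_pmf p \<Longrightarrow> finite (set_pmf (f x))"
    and "\<And>x. x \<in> set_pmf p \<Longrightarrow> measure_pmf.expectation (f x) h \<le> g x"
  shows "measure_pmf.expectation (bind_pmf p f) h \<le> measure_pmf.expectation p g"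
proof -
  have "measure_pmf.expectation (bind_pmf p f) h
      = (\<Sum>x\<in>set_pmf p. pmf p x * measure_pmf.expectation (f x) h)"
    using pmf_expectation_bind[of "set_pmf p" f p h] assms by simp
  also have "\<dots> \<le> (\<Sum>x\<in>set_pmf p. pmf p x * g x)"
    using assms(3) by (intro sum_mono mult_left_mono) auto
  also have "\<dots> = measure_pmf.expectation p g"
    using integral_measure_pmf[of "set_pmf p" p g] assms(1) by simp
  finally show ?thesis .
qed

lemma expectation_mono_finite:
  fixes f g :: "'b \<Rightarrow> real"
  assumes "finite (set_pmf p)" "\<And>x. x \<in> set_pmf p \<Longrightarrow> f x \<le> g x"
  shows "measure_pmf.expectation p f \<le> measure_pmf.expectation p g"
  using assms by (intro integral_mono_AE integrable_measure_pmf_finite) (auto simp: AE_measure_pmf_iff)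

lemma possible_history_take:
  "possible_history A Z \<Phi> h \<Longrightarrow> possible_history A Z \<Phi> (take s h)"
  unfolding possible_history_def using set_take_subset[of s h] by blast

text \<open>Finite support makes every real function of the history integrable; the invariants allow
  the assumptions on possible histories to be used on every prefix.\<close>

lemma set_pmf_interaction:
  assumes "finite A"
    and P: "\<And>h. possible_history A Z \<Phi> h \<Longrightarrow> length h < n \<Longrightarrow> set_pmf (P h) = A"
    and z: "\<And>t. t \<in> {1..n} \<Longrightarrow> z t \<in> Z"
    and "m \<le> n"
  shows "finite (set_pmf (interaction \<Phi> P z m))"
    and "\<And>h. h \<in> set_pmf (interaction \<Phi> P z m) \<Longrightarrow> possible_history A Z \<Phi> h \<and> length h = m \<and>
      (\<forall>s<m. snd (h ! s) = \<Phi> (fst (h ! s)) (z (Suc s)))"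
  using \<open>m \<le> n\<close>
proof (induction m)
  case 0
  {
    case 1 show ?case by simp
  next
    case 2 then show ?case by (simp add: possible_history_def)
  }
next
  case (Suc m)
  {
    case 1
    then show ?case using Suc P assms(1) by auto
  next
    case (2 h)
    then obtain h' a where h: "h' \<in> set_pmf (interaction \<Phi> P z m)" "a \<in> set_pmf (P h')"
      "h = h' @ [(a, \<Phi> a (z (Suc m)))]" by auto
    have h': "possible_history A Z \<Phi> h'" "length h' = m"
      "\<forall>s<m. snd (h' ! s) = \<Phi> (fst (h' ! s)) (z (Suc s))"
      using Suc.IH(2)[OF h(1)] 2 by auto
    have "a \<in> A" using h(2) P h' 2 by auto
    moreover have "z (Suc m) \<in> Z" using z 2 by auto
    ultimately show ?case using h' h(3)
      by (auto simp: possible_history_def nth_append less_Suc_eq)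
  }
qed

text \<open>Tower property: given the history \<open>h\<close>, the contribution
  \<open>Y h a\<close> of the next round has mean at most \<open>c\<close>, and earlier
  contributions are fixed by \<open>h\<close>.\<close>

lemma interaction_expectation_le:
  fixes Y :: "('d, 's) history \<Rightarrow> real^'d \<Rightarrow> real"
  assumes "finite A"
    and P: "\<And>h. possible_history A Z \<Phi> h \<Longrightarrow> length h < n \<Longrightarrow> set_pmf (P h) = A"
    and z: "\<And>t. t \<in> {1..n} \<Longrightarrow> z t \<in> Z"
    and Y: "\<And>h. possible_history A Z \<Phi> h \<Longrightarrow> length h < n \<Longrightarrow> (\<Sum>a\<in>A. pmf (P h) a * Y h a) \<le> c"
    and "m \<le> n"
  shows "measure_pmf.expectation (interaction \<Phi> P z m) (\<lambda>h. \<Sum>s<m. Y (take s h) (fst (h ! s)))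
     \<le> real m * c"
  using \<open>m \<le> n\<close>
proof (induction m)
  case 0
  then show ?case by simp
next
  case (Suc m)
  note supp = set_pmf_interaction[of A Z \<Phi> n P z m, OF assms(1) P z]
  let ?V = "\<lambda>m h. \<Sum>s<m. Y (take s h) (fst (h ! s))"
  have fin: "finite (set_pmf (interaction \<Phi> P z m))" using supp(1) Suc.prems by simp
  have "measure_pmf.expectation (interaction \<Phi> P z (Suc m)) (?V (Suc m))
    \<le> measure_pmf.expectation (interaction \<Phi> P z m) (\<lambda>h. ?V m h + c)"
    unfolding interaction.simps
  proof (rule expectation_bind_pmf_le[OF fin])
    fix h assume "h \<in> set_pmf (interaction \<Phi> P z m)"
    then have h: "possible_history A Z \<Phi> h" "length h = m" using supp(2) Suc.prems by auto
    have PA: "set_pmf (P h) = A" using P h Suc.prems by simp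
    then show "finite (set_pmf (map_pmf (\<lambda>a. h @ [(a, \<Phi> a (z (Suc m)))]) (P h)))"
      using assms(1) by simp
    \<comment> \<open>Appending an entry leaves the first \<open>m\<close> contributions unchanged,
      and the prefix of length \<open>m\<close> is \<open>h\<close> itself.\<close>
    have "measure_pmf.expectation (map_pmf (\<lambda>a. h @ [(a, \<Phi> a (z (Suc m)))]) (P h)) (?V (Suc m))
      = measure_pmf.expectation (P h) (\<lambda>a. ?V m h + Y h a)"
      using h(2) by (simp add: nth_append)
    also have "\<dots> = (\<Sum>a\<in>A. pmf (P h) a * (?V m h + Y h a))"
      using PA assms(1) by (subst integral_measure_pmf[of A]) auto
    also have "\<dots> = (\<Sum>a\<in>A. pmf (P h) a) * ?V m h + (\<Sum>a\<in>A. pmf (P h) a * Y h a)"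
      by (simp add: distrib_left sum.distrib flip: sum_distrib_right)
    also have "(\<Sum>a\<in>A. pmf (P h) a) = 1"
      using PA assms(1) by (intro sum_pmf_eq_1) auto
    also have "1 * ?V m h + (\<Sum>a\<in>A. pmf (P h) a * Y h a) \<le> ?V m h + c"
      using Y[OF h(1)] h(2) Suc.prems by simp
    finally show "measure_pmf.expectation (map_pmf (\<lambda>a. h @ [(a, \<Phi> a (z (Suc m)))]) (P h)) (?V (Suc m))
      \<le> ?V m h + c" .
  qed
  also have "\<dots> = measure_pmf.expectation (interaction \<Phi> P z m) (?V m) + c"
    by (subst Bochner_Integration.integral_add)
      (auto intro!: integrable_measure_pmf_finite fin)
  finally show ?case using Suc by (simp add: distrib_right)
qed

section \<open>Estimates and learning rates along a history\<close>

lemma loss_estimate_take: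
  "s \<le> length h \<Longrightarrow> i < s \<Longrightarrow> loss_estimate P G (take s h) i = loss_estimate P G h i"
  by (simp add: loss_estimate_def min_def)

lemma cum_beta_take:
  assumes "s \<le> length h"
  shows "cum_beta \<beta> (take s h) = (\<Sum>i<s. \<beta> (snd (h ! i)) (fst (h ! i)))"
  using assms by (simp add: cum_beta_def sum_list_sum_nth case_prod_beta atLeast0LessThan)

lemma learning_rate_pos:
  assumes "1 < lam" "0 < dm" "0 < \<beta>0 + cum_beta \<beta> h"
  shows "0 < learning_rate lam dm \<beta>0 \<beta> h"
  using assms by (simp add: learning_rate_def)

lemma learning_rate_mono:
  assumes "1 < lam" "0 < dm" "0 < \<beta>0 + cum_beta \<beta> h" "cum_beta \<beta> h \<le> cum_beta \<beta> h'"
  shows "learning_rate lam dm \<beta>0 \<beta> h' \<le> learning_rate lam dm \<beta>0 \<beta> h"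
  unfolding learning_rate_def using assms
  by (intro mult_left_mono powr_mono2 divide_left_mono) auto

text \<open>An identity of logarithms. The last exponent is written as \<open>\<kappa> - 1\<close>
  with \<open>\<kappa> = 1 - 1 / lam\<close>, the form in which the power sums are bounded.\<close>

lemma learning_rate_powr:
  assumes "1 < lam" "0 < dm" "0 < \<beta>0 + cum_beta \<beta> h"
  shows "(learning_rate lam dm \<beta>0 \<beta> h / lam) powr (1 / (lam - 1))
     = ((lam - 1) / lam * dm) powr (1 / lam) * (\<beta>0 + cum_beta \<beta> h) powr ((1 - 1 / lam) - 1)"
proof -
  let ?B = "\<beta>0 + cum_beta \<beta> h"
  have "ln (learning_rate lam dm \<beta>0 \<beta> h / lam) =
      1 / lam * ln lam + (1 - 1 / lam) * ln (lam - 1) + (1 - 1 / lam) * (ln dm - ln ?B) - ln lam"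
    unfolding learning_rate_def using assms by (simp add: ln_mult ln_div)
  then have "1 / (lam - 1) * ln (learning_rate lam dm \<beta>0 \<beta> h / lam)
      = 1 / lam * (ln (lam - 1) - ln lam + ln dm) + ((1 - 1 / lam) - 1) * ln ?B"
    using assms by (simp add: divide_simps) (simp add: algebra_simps)
  also have "ln (lam - 1) - ln lam + ln dm = ln ((lam - 1) / lam * dm)"
    using assms by (simp add: ln_mult ln_div)
  finally have "exp (1 / (lam - 1) * ln (learning_rate lam dm \<beta>0 \<beta> h / lam))
      = exp (1 / lam * ln ((lam - 1) / lam * dm)) * exp (((1 - 1 / lam) - 1) * ln ?B)"
    by (simp only: exp_add)
  then show ?thesis
    using assms learning_rate_pos[OF assms] by (simp add: powr_def)
qed

text \<open>Again by logarithms: the regularisation penalty carries the same constant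
  \<open>((lam - 1) / lam * dm) powr (1 / lam)\<close> as the stability terms, so the two can be
  added.\<close>

lemma diam_div_learning_rate:
  assumes "1 < lam" "0 < dm" "0 < \<beta>0 + cum_beta \<beta> h"
  shows "dm / learning_rate lam dm \<beta>0 \<beta> h
     = 1 / (lam - 1) * ((lam - 1) / lam * dm) powr (1 / lam) * (\<beta>0 + cum_beta \<beta> h) powr (1 - 1 / lam)"
proof -
  let ?B = "\<beta>0 + cum_beta \<beta> h"
  have pos: "0 < learning_rate lam dm \<beta>0 \<beta> h" by (rule learning_rate_pos[OF assms])
  have "ln (dm / learning_rate lam dm \<beta>0 \<beta> h)
     = ln dm - (1 / lam * ln lam + (1 - 1 / lam) * ln (lam - 1) + (1 - 1 / lam) * (ln dm - ln ?B))"
    using assms pos by (simp add: ln_div) (simp add: learning_rate_def ln_mult ln_div)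
  also have "\<dots> = - ln (lam - 1) + 1 / lam * (ln (lam - 1) - ln lam + ln dm) + (1 - 1 / lam) * ln ?B"
    using assms by (simp add: divide_simps) (simp add: algebra_simps)
  also have "\<dots> = ln (1 / (lam - 1) * ((lam - 1) / lam * dm) powr (1 / lam) * ?B powr (1 - 1 / lam))"
    using assms by (simp add: ln_mult ln_div)
  finally show ?thesis
    using assms pos by simp
qed

text \<open>The summand \<open>1 / (lam - 1)\<close> comes from the penalty and \<open>1\<close>
  from the stability terms.\<close>

lemma regret_constant:
  fixes lam dm :: real
  assumes "1 < lam" "0 < dm"
  shows "(1 / (lam - 1) + 1) * ((lam - 1) / lam * dm) powr (1 / lam)
     = (lam / (lam - 1)) powr (1 - 1 / lam) * dm powr (1 / lam)"
proof -
  have 1: "1 / (lam - 1) + 1 = lam / (lam - 1)" using assms add_divide_distrib[of "lam - 1" 1 "lam - 1"] by simp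
  have 2: "((lam - 1) / lam) powr (1 / lam) = (lam / (lam - 1)) powr (- (1 / lam))"
    using assms by (simp add: powr_minus powr_divide)
  have 3: "lam / (lam - 1) * (lam / (lam - 1)) powr (- (1 / lam)) = (lam / (lam - 1)) powr (1 - 1 / lam)"
    using assms powr_mult_base[of "lam / (lam - 1)" "- (1 / lam)"] by simp
  have 4: "((lam - 1) / lam * dm) powr (1 / lam) = ((lam - 1) / lam) powr (1 / lam) * dm powr (1 / lam)"
    by (rule powr_mult)
  show ?thesis unfolding 1 4 2 mult.assoc[symmetric] 3 ..
qed

section \<open>From competing with \<open>D\<close> to competing with actions\<close>

text \<open>Replacing the benchmark \<open>a\<close> by \<open>b\<close> costs at most the supremum
  of \<open>(b - a) \<bullet> l z\<close> in each round. Since \<open>R\<close> is the same for all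
  \<open>b\<close>, the infimum over \<open>b\<close> may be taken.\<close>

lemma regret_le_eps_D:
  assumes game: "linear_pm_game A S Z \<Phi> l" and dom: "standing_domain A D F"
    and z: "\<And>t. t \<in> {1..n} \<Longrightarrow> z t \<in> Z" and n: "1 \<le> n"
    and fin: "finite (set_pmf (interaction \<Phi> P z n))"
    and R: "\<And>b. b \<in> D \<Longrightarrow> measure_pmf.expectation (interaction \<Phi> P z n)
        (\<lambda>h. \<Sum>t=1..n. (fst (h ! (t - 1)) - b) \<bullet> l (z t)) \<le> R"
  shows "regret A \<Phi> l P z n \<le> R + real n * eps_D A Z l D"
proof -
  let ?E = "\<lambda>b. measure_pmf.expectation (interaction \<Phi> P z n)
        (\<lambda>h. \<Sum>t=1..n. (fst (h ! (t - 1)) - b) \<bullet> l (z t))"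
  let ?f = "\<lambda>a b. SUP z\<in>Z. (b - a) \<bullet> l z"
  have A: "finite A" "A \<noteq> {}" using game by (auto simp: linear_pm_game_def)
  have D: "D \<noteq> {}" using dom by (auto simp: standing_domain_def)
  have lb: "norm (l z') \<le> CARD('a)" if "z' \<in> Z" for z'
  proof -
    have "norm (l z') \<le> (\<Sum>i\<in>UNIV. \<bar>l z' $ i\<bar>)" by (rule norm_le_l1_cart)
    also have "\<dots> \<le> (\<Sum>i\<in>(UNIV::'a set). 1)"
      using game that by (intro sum_mono) (auto simp: linear_pm_game_def)
    finally show ?thesis by simp
  qed
  \<comment> \<open>A real supremum bounds its members only if the set is bounded above; here the
    losses are bounded coordinatewise.\<close>
  have bdd: "bdd_above ((\<lambda>z. (b - a) \<bullet> l z) ` Z)" for a b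
  proof (rule bdd_aboveI2)
    fix z' assume "z' \<in> Z"
    have "(b - a) \<bullet> l z' \<le> norm (b - a) * norm (l z')" by (rule norm_cauchy_schwarz)
    also have "\<dots> \<le> norm (b - a) * CARD('a)" using lb[OF \<open>z' \<in> Z\<close>] by (intro mult_left_mono) auto
    finally show "(b - a) \<bullet> l z' \<le> norm (b - a) * CARD('a)" .
  qed
  have "?E a \<le> R + real n * eps_D A Z l D" if a: "a \<in> A" for a
  proof -
    have "(?E a - R) / real n \<le> ?f a b" if b: "b \<in> D" for b
    proof -
      have "?E a = measure_pmf.expectation (interaction \<Phi> P z n)
        (\<lambda>h. (\<Sum>t=1..n. (fst (h ! (t - 1)) - b) \<bullet> l (z t)) + (\<Sum>t=1..n. (b - a) \<bullet> l (z t)))"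
        by (simp add: inner_diff_left flip: sum.distrib)
      also have "\<dots> = ?E b + (\<Sum>t=1..n. (b - a) \<bullet> l (z t))"
        by (subst Bochner_Integration.integral_add)
          (auto intro!: integrable_measure_pmf_finite fin)
      also have "\<dots> \<le> R + (\<Sum>t=1..n. ?f a b)"
        using z R[OF b] bdd by (intro add_mono sum_mono cSUP_upper) auto
      finally show ?thesis using n by (simp add: field_simps)
    qed
    then have "(?E a - R) / real n \<le> (INF b\<in>D. ?f a b)"
      using D by (intro cINF_greatest) auto
    also have "\<dots> \<le> eps_D A Z l D"
      unfolding eps_D_def using A a by (intro Max_ge) auto
    finally show ?thesis using n by (simp add: field_simps)
  qed
  then show ?thesis unfolding regret_def using A by (intro Max.boundedI) auto
qed

section \<open>Regret with the adaptive learning rate\<close>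

theorem theorem18:
  fixes A D :: "(real^'d) set"
    and S :: "'s set"
    and Z :: "'z set"
    and \<Phi> :: "real^'d \<Rightarrow> 'z \<Rightarrow> 's"
    and l :: "'z \<Rightarrow> real^'d"
    and F :: "real^'d \<Rightarrow> ereal"
    and \<alpha> lam dm \<beta>0 \<epsilon> :: real
    and \<beta> :: "'s \<Rightarrow> real^'d \<Rightarrow> real"
    and n :: nat
    and Q :: "('d, 's) history \<Rightarrow> real^'d"
    and P :: "('d, 's) history \<Rightarrow> (real^'d) pmf"
    and G :: "('d, 's) history \<Rightarrow> real^'d \<Rightarrow> 's \<Rightarrow> real^'d"
    and z :: "nat \<Rightarrow> 'z"
  assumes game: "linear_pm_game A S Z \<Phi> l"
    and legendre: "Legendre_fun F"
    and dom: "standing_domain A D F"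
    and diam: "ereal dm = diamF F D"
    and diam_pos: "0 < dm"
    and lam_gt1: "1 < lam"
    and beta_nonneg: "\<And>a z'. a \<in> A \<Longrightarrow> z' \<in> Z \<Longrightarrow> 0 \<le> \<beta> (\<Phi> a z') a"
    and air: "adaptive_information_ratio A Z \<Phi> l D F \<alpha> (\<lambda>z' a. \<beta> (\<Phi> a z') a) lam"
    and beta0: "ereal \<beta>0 = (SUP \<sigma>\<in>S. ereal (MAX a\<in>A. \<beta> \<sigma> a))"
    and beta0_pos: "0 < \<beta>0"
    and n: "1 \<le> n"
    and eps: "0 < \<epsilon>"
    and Q_dom: "\<And>h. possible_history A Z \<Phi> h \<Longrightarrow> length h < n \<Longrightarrow> Q h \<in> D \<inter> dom_gradient F"
    and Q_argmin: "\<And>h. possible_history A Z \<Phi> h \<Longrightarrow> length h < n \<Longrightarrow>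
          is_arg_min (ftrl_objective F P G (learning_rate lam dm \<beta>0 \<beta> h) h) (\<lambda>q. q \<in> D) (Q h)"
    and P_pos: "\<And>h. possible_history A Z \<Phi> h \<Longrightarrow> length h < n \<Longrightarrow> set_pmf (P h) = A"
    and PG_opt: "\<And>h. possible_history A Z \<Phi> h \<Longrightarrow> length h < n \<Longrightarrow>
          (SUP (z', b)\<in>Z \<times> D.
             Lam A \<Phi> l F (Q h) (learning_rate lam dm \<beta>0 \<beta> h) z' b
                (P h) (G h) -
             ereal ((1 - 1 / lam) * (learning_rate lam dm \<beta>0 \<beta> h / lam) powr (1 / (lam - 1)) *
                    (\<Sum>a\<in>A. pmf (P h) a * \<beta> (\<Phi> a z') a)))
          \<le> ereal (\<epsilon> + \<alpha>)"
    and z: "\<And>t. t \<in> {1..n} \<Longrightarrow> z t \<in> Z"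
  shows "regret A \<Phi> l P z n
     \<le> real n * (\<epsilon> + eps_D A Z l D + \<alpha>) +
        (lam / (lam - 1)) powr (1 - 1 / lam) * dm powr (1 / lam) *
        measure_pmf.expectation (interaction \<Phi> P z n)
          (\<lambda>h. (\<beta>0 + cum_beta \<beta> (take (n - 1) h)) powr (1 - 1 / lam))"
proof -
  define \<kappa> where "\<kappa> = 1 - 1 / lam"
  define K where "K = ((lam - 1) / lam * dm) powr (1 / lam)"
  define \<eta> where "\<eta> = learning_rate lam dm \<beta>0 \<beta>"
  define f where "f = (\<lambda>x. real_of_ereal (F x))"
  define m where "m = f (Q [])"
  define coef where "coef = (\<lambda>h. \<kappa> * (\<eta> h / lam) powr (1 / (lam - 1)))"
  define \<psi> where "\<psi> = (\<lambda>h a \<sigma>. real_of_ereal (Psi F (Q h) ((\<eta> h / pmf (P h) a) *\<^sub>R G h a \<sigma>)))"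
  \<comment> \<open>The balance of one round against \<open>b\<close>: true minus estimated loss
    difference, plus stability, minus the allowance in \<open>\<beta>\<close>. Its conditional mean
    is at most \<open>\<epsilon> + \<alpha>\<close>.\<close>
  define Y where "Y = (\<lambda>b h a. let z' = z (Suc (length h)) in
     (a - b) \<bullet> l z' - (Q h - b) \<bullet> ((1 / pmf (P h) a) *\<^sub>R G h a (\<Phi> a z')) + \<psi> h a (\<Phi> a z') / \<eta> h
     - coef h * \<beta> (\<Phi> a z') a)"
  have \<kappa>: "0 < \<kappa>" "\<kappa> < 1" using lam_gt1 by (auto simp: \<kappa>_def)
  have A: "finite A" "A \<noteq> {}" using game by (auto simp: linear_pm_game_def)
  have proper: "proper_fun F" using legendre by (simp add: Legendre_fun_def)
  have D: "convex D" "D \<subseteq> eff_dom F" using dom by (auto simp: standing_domain_def)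
  have Ff: "F x = ereal (f x)" if "x \<in> D" for x
    using ereal_real_eff_dom[OF proper] that D(2) by (auto simp: f_def)
  have \<beta>0_le: "\<beta> (\<Phi> a z') a \<le> \<beta>0" if "a \<in> A" "z' \<in> Z" for a z'
  proof -
    have "\<beta> (\<Phi> a z') a \<le> (MAX a'\<in>A. \<beta> (\<Phi> a z') a')" using A that by (intro Max_ge) auto
    moreover have "ereal (MAX a'\<in>A. \<beta> (\<Phi> a z') a') \<le> ereal \<beta>0"
      unfolding beta0 using game that by (intro SUP_upper) (auto simp: linear_pm_game_def)
    ultimately show ?thesis by simp
  qed
  have cb: "0 \<le> cum_beta \<beta> h" if "possible_history A Z \<Phi> h" for h
    unfolding cum_beta_def using that beta_nonneg
    by (intro sum_list_nonneg) (auto simp: possible_history_def)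
  have Bpos: "0 < \<beta>0 + cum_beta \<beta> h" if "possible_history A Z \<Phi> h" for h
    using cb[OF that] beta0_pos by simp
  have \<eta>_pos: "0 < \<eta> h" if "possible_history A Z \<Phi> h" for h
    unfolding \<eta>_def by (rule learning_rate_pos[OF lam_gt1 diam_pos Bpos[OF that]])
  \<comment> \<open>With the empty history the objective is a positive multiple of \<open>F\<close>,
    so the first iterate minimises \<open>F\<close> over \<open>D\<close>.\<close>
  have m: "m \<le> f w" "f w \<le> m + dm" if "w \<in> D" for w
  proof -
    have Q0: "Q [] \<in> D" using Q_dom[of "[]"] n by (simp add: possible_history_def)
    have "\<not> F w / ereal (\<eta> []) < F (Q []) / ereal (\<eta> [])"
      using Q_argmin[of "[]"] n that
      by (auto simp: possible_history_def is_arg_min_def ftrl_objective_def \<eta>_def zero_ereal_def[symmetric])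
    then show "m \<le> f w"
      using \<eta>_pos[of "[]"] Ff[OF that] Ff[OF Q0]
      by (auto simp: possible_history_def m_def not_less divide_le_cancel)
    have "F w - F (Q []) \<le> ereal dm"
      unfolding diam diamF_def using that Q0 by (intro SUP_upper2[of w] SUP_upper)
    then show "f w \<le> m + dm" using Ff[OF that] Ff[OF Q0] by (simp add: m_def)
  qed
  have round: "Psi F (Q h) ((\<eta> h / pmf (P h) a) *\<^sub>R G h a (\<Phi> a z')) = ereal (\<psi> h a (\<Phi> a z'))"
    "(\<Sum>a\<in>A. pmf (P h) a * ((a - b) \<bullet> l z' - (Q h - b) \<bullet> ((1 / pmf (P h) a) *\<^sub>R G h a (\<Phi> a z'))
       + \<psi> h a (\<Phi> a z') / \<eta> h)) \<le> (\<epsilon> + \<alpha>) + coef h * (\<Sum>a\<in>A. pmf (P h) a * \<beta> (\<Phi> a z') a)"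
    if h: "possible_history A Z \<Phi> h" "length h < n" and "z' \<in> Z" "b \<in> D" "a \<in> A" for h z' b a
  proof -
    have "Lam A \<Phi> l F (Q h) (\<eta> h) z' b (P h) (G h)
        - ereal (coef h * (\<Sum>a\<in>A. pmf (P h) a * \<beta> (\<Phi> a z') a)) \<le> ereal (\<epsilon> + \<alpha>)"
      using order_trans[OF SUP_upper[of "(z', b)" "Z \<times> D"] PG_opt[OF h]] that
      by (simp add: \<eta>_def coef_def \<kappa>_def)
    note L = Lam_le_imp[OF legendre A(1) _ P_pos[OF h] \<eta>_pos[OF h(1)] this]
    show "Psi F (Q h) ((\<eta> h / pmf (P h) a) *\<^sub>R G h a (\<Phi> a z')) = ereal (\<psi> h a (\<Phi> a z'))"
      "(\<Sum>a\<in>A. pmf (P h) a * ((a - b) \<bullet> l z' - (Q h - b) \<bullet> ((1 / pmf (P h) a) *\<^sub>R G h a (\<Phi> a z'))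
       + \<psi> h a (\<Phi> a z') / \<eta> h)) \<le> (\<epsilon> + \<alpha>) + coef h * (\<Sum>a\<in>A. pmf (P h) a * \<beta> (\<Phi> a z') a)"
      using L Q_dom[OF h] that(5) unfolding \<psi>_def by auto
  qed
  have Y_le: "(\<Sum>a\<in>A. pmf (P h) a * Y b h a) \<le> \<epsilon> + \<alpha>"
    if h: "possible_history A Z \<Phi> h" "length h < n" and b: "b \<in> D" for h b
  proof -
    have zZ: "z (Suc (length h)) \<in> Z" using z h(2) by simp
    obtain a where "a \<in> A" using A(2) by blast
    from round(2)[OF h zZ b this] show ?thesis
      by (simp add: Y_def Let_def right_diff_distrib sum_subtractf sum_distrib_left mult.left_commute
          del: inner_scaleR_right)
  qed
  have supp: "finite (set_pmf (interaction \<Phi> P z n))"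
    "\<And>h. h \<in> set_pmf (interaction \<Phi> P z n) \<Longrightarrow> possible_history A Z \<Phi> h \<and> length h = n \<and>
      (\<forall>s<n. snd (h ! s) = \<Phi> (fst (h ! s)) (z (Suc s)))"
    using set_pmf_interaction[of A Z \<Phi> n P z n] A(1) P_pos z by blast+
  define W where "W = (\<lambda>h. (lam / (lam - 1)) powr (1 - 1 / lam) * dm powr (1 / lam)
    * (\<beta>0 + cum_beta \<beta> (take (n - 1) h)) powr (1 - 1 / lam))"
  \<comment> \<open>This holds on each history in the support; only the sum of the \<open>Y\<close>
    terms is left to the averaging argument.\<close>
  have path: "(\<Sum>t=1..n. (fst (h ! (t - 1)) - b) \<bullet> l (z t))
      \<le> (\<Sum>s<n. Y b (take s h) (fst (h ! s))) + W h"
    if hs: "h \<in> set_pmf (interaction \<Phi> P z n)" and b: "b \<in> D" for h b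
  proof -
    \<comment> \<open>Rounds are counted from \<open>0\<close> here, so \<open>k\<close> is the last
      one and its learning rate depends on the first \<open>n - 1\<close> observations.\<close>
    obtain k where k: "n = Suc k" using n by (cases n) auto
    have h: "possible_history A Z \<Phi> h" "length h = n"
      and sig: "\<And>s. s < n \<Longrightarrow> snd (h ! s) = \<Phi> (fst (h ! s)) (z (Suc s))"
      using supp(2)[OF hs] by auto
    have ph: "possible_history A Z \<Phi> (take s h)" for s
      by (rule possible_history_take[OF h(1)])
    have aA: "fst (h ! s) \<in> A" if "s < n" for s
      using h that nth_mem[of s h] unfolding possible_history_def by (auto simp: case_prod_beta)
    let ?q = "\<lambda>s. Q (take s h)" and ?e = "loss_estimate P G h" and ?\<eta> = "\<lambda>s. \<eta> (take s h)"
    let ?\<beta> = "\<lambda>s. \<beta> (snd (h ! s)) (fst (h ! s))"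
    let ?\<psi> = "\<lambda>s. \<psi> (take s h) (fst (h ! s)) (snd (h ! s))"
    have e: "?e s = (1 / pmf (P (take s h)) (fst (h ! s))) *\<^sub>R G (take s h) (fst (h ! s)) (snd (h ! s))" for s
      by (simp add: loss_estimate_def case_prod_beta)
    have len: "length (take s h) < n" "length (take s h) = s" if "s < n" for s
      using that h(2) by auto
    have cumb: "cum_beta \<beta> (take s h) = (\<Sum>i<s. ?\<beta> i)" if "s < n" for s
      by (rule cum_beta_take) (use that h(2) in simp)
    have \<beta>s: "0 \<le> ?\<beta> s" "?\<beta> s \<le> \<beta>0" if "s < n" for s
      using beta_nonneg \<beta>0_le aA[OF that] z[of "Suc s"] sig[OF that] that by auto
    have ftrl: "(\<Sum>i\<le>k. (?q i - b) \<bullet> ?e i) \<le> dm / ?\<eta> k + (\<Sum>i\<le>k. ?\<psi> i / ?\<eta> i)"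
    proof (rule ftrl_regret_bound[where D = D and f = f and m = m])
      fix s w assume s: "s \<le> k" and w: "w \<in> D"
      then have sn: "s < n" by (simp add: k)
      have qD: "?q s \<in> D" "?q s \<in> dom_gradient F" using Q_dom[OF ph len(1)[OF sn]] by auto
      \<comment> \<open>On \<open>D\<close> the objective is real, and estimates computed from a
        prefix agree with those of the full history; thus the minimality of \<open>Q\<close> becomes
        a real inequality.\<close>
      have obj: "ftrl_objective F P G (?\<eta> s) (take s h) y = ereal ((\<Sum>i<s. ?e i) \<bullet> y + f y / ?\<eta> s)"
        if "y \<in> D" for y
        using less_imp_neq[OF \<eta>_pos[OF ph], symmetric] Ff[OF that] sn h(2)
        by (simp add: ftrl_objective_def loss_estimate_take inner_sum_left inner_sum_right inner_commute)
      have min: "(\<Sum>i<s. ?e i) \<bullet> ?q s + f (?q s) / ?\<eta> s \<le> (\<Sum>i<s. ?e i) \<bullet> y + f y / ?\<eta> s"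
        if "y \<in> D" for y
        using Q_argmin[OF ph len(1)[OF sn]] obj[OF that] obj[OF qD(1)] that
        unfolding is_arg_min_def \<eta>_def[symmetric] by (metis less_ereal.simps(1) not_less)
      have "Psi F (?q s) (?\<eta> s *\<^sub>R ?e s) = ereal (?\<psi> s)"
        using round(1)[OF ph len(1)[OF sn] _ b aA[OF sn], of "z (Suc s)"] sig[OF sn] z[of "Suc s"] sn
        by (simp add: e)
      from ftrl_step[OF legendre qD(2) D qD(1) w \<eta>_pos[OF ph] min[unfolded f_def] this]
      show "(\<Sum>i<s. ?q s \<bullet> ?e i) + f (?q s) / ?\<eta> s + ?q s \<bullet> ?e s - ?\<psi> s / ?\<eta> s
        \<le> (\<Sum>i<s. w \<bullet> ?e i) + f w / ?\<eta> s + w \<bullet> ?e s"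
        by (simp add: f_def inner_sum_left inner_sum_right inner_commute)
    next
      fix s assume "s \<le> k" then show "?q s \<in> D" using Q_dom[OF ph len(1)] k by auto
    next
      fix s show "0 < ?\<eta> s" by (rule \<eta>_pos[OF ph])
    next
      fix s assume "s < k"
      then show "?\<eta> (Suc s) \<le> ?\<eta> s"
        unfolding \<eta>_def using \<beta>s[of s] k
        by (intro learning_rate_mono lam_gt1 diam_pos Bpos ph) (auto simp: cumb)
    qed (use m b in auto)
    have "(\<Sum>i\<le>k. coef (take i h) * ?\<beta> i)
        = K * (\<kappa> * (\<Sum>i\<le>k. ?\<beta> i * (\<beta>0 + (\<Sum>j<i. ?\<beta> j)) powr (\<kappa> - 1)))"
      unfolding sum_distrib_left coef_def \<eta>_def
      using learning_rate_powr[OF lam_gt1 diam_pos Bpos[OF ph]] cumb k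
      by (intro sum.cong) (auto simp: K_def \<kappa>_def)
    also have "\<dots> \<le> K * (\<beta>0 + (\<Sum>j<k. ?\<beta> j)) powr \<kappa>"
      using \<beta>s k \<kappa> beta0_pos by (intro mult_left_mono sum_powr_bound) (auto simp: K_def)
    finally have coefs: "(\<Sum>i\<le>k. coef (take i h) * ?\<beta> i) \<le> K * (\<beta>0 + cum_beta \<beta> (take k h)) powr \<kappa>"
      using cumb k by simp
    have "dm / ?\<eta> k = 1 / (lam - 1) * K * (\<beta>0 + cum_beta \<beta> (take k h)) powr \<kappa>"
      unfolding \<eta>_def K_def \<kappa>_def by (rule diam_div_learning_rate[OF lam_gt1 diam_pos Bpos[OF ph]])
    then have "dm / ?\<eta> k + (\<Sum>i\<le>k. coef (take i h) * ?\<beta> i)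
        \<le> (1 / (lam - 1) + 1) * K * (\<beta>0 + cum_beta \<beta> (take k h)) powr \<kappa>"
      using coefs by (simp add: distrib_right)
    also have "\<dots> = W h"
      unfolding K_def regret_constant[OF lam_gt1 diam_pos] W_def \<kappa>_def by (simp add: k)
    finally have W: "dm / ?\<eta> k + (\<Sum>i\<le>k. coef (take i h) * ?\<beta> i) \<le> W h" .
    \<comment> \<open>The prefix has length \<open>s\<close>, so \<open>Y\<close> refers to the
      latent value \<open>z (Suc s)\<close>, which generated the recorded signal.\<close>
    have "Y b (take s h) (fst (h ! s)) = (fst (h ! s) - b) \<bullet> l (z (Suc s)) - (?q s - b) \<bullet> ?e s
        + ?\<psi> s / ?\<eta> s - coef (take s h) * ?\<beta> s" if "s < n" for s
      using sig[OF that] len(2)[OF that] by (simp add: Y_def e Let_def)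
    then have "(\<Sum>s<n. Y b (take s h) (fst (h ! s))) = (\<Sum>s\<le>k. (fst (h ! s) - b) \<bullet> l (z (Suc s)))
        - (\<Sum>s\<le>k. (?q s - b) \<bullet> ?e s) + (\<Sum>s\<le>k. ?\<psi> s / ?\<eta> s) - (\<Sum>s\<le>k. coef (take s h) * ?\<beta> s)"
      by (simp add: k lessThan_Suc_atMost sum_subtractf sum.distrib)
    moreover have "(\<Sum>t=1..n. (fst (h ! (t - 1)) - b) \<bullet> l (z t)) = (\<Sum>s\<le>k. (fst (h ! s) - b) \<bullet> l (z (Suc s)))"
      unfolding k by (rule sum.reindex_bij_witness[where i = Suc and j = "\<lambda>t. t - 1"]) auto
    ultimately show ?thesis using ftrl W by linarith
  qed
  have "regret A \<Phi> l P z n \<le> (real n * (\<epsilon> + \<alpha>) + measure_pmf.expectation (interaction \<Phi> P z n) W)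
      + real n * eps_D A Z l D"
  proof (rule regret_le_eps_D[OF game dom z n supp(1)])
    fix b assume b: "b \<in> D"
    have "measure_pmf.expectation (interaction \<Phi> P z n) (\<lambda>h. \<Sum>t=1..n. (fst (h ! (t - 1)) - b) \<bullet> l (z t))
      \<le> measure_pmf.expectation (interaction \<Phi> P z n)
          (\<lambda>h. (\<Sum>s<n. Y b (take s h) (fst (h ! s))) + W h)"
      using path b by (intro expectation_mono_finite supp(1))
    also have "\<dots> = measure_pmf.expectation (interaction \<Phi> P z n) (\<lambda>h. \<Sum>s<n. Y b (take s h) (fst (h ! s)))
        + measure_pmf.expectation (interaction \<Phi> P z n) W"
      by (intro Bochner_Integration.integral_add integrable_measure_pmf_finite supp(1))
    also have "measure_pmf.expectation (interaction \<Phi> P z n) (\<lambda>h. \<Sum>s<n. Y b (take s h) (fst (h ! s)))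
        \<le> real n * (\<epsilon> + \<alpha>)"
      by (rule interaction_expectation_le[OF A(1) P_pos z Y_le[OF _ _ b] order_refl])
    finally show "measure_pmf.expectation (interaction \<Phi> P z n) (\<lambda>h. \<Sum>t=1..n. (fst (h ! (t - 1)) - b) \<bullet> l (z t))
        \<le> real n * (\<epsilon> + \<alpha>) + measure_pmf.expectation (interaction \<Phi> P z n) W" by simp
  qed
  then show ?thesis by (simp add: W_def distrib_left algebra_simps)
qed

end
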